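(* Let $I\subset\mathbb R$ be a nondegenerate compact interval. Then: (a) $\mathcal R^{lc}_0(I)$ and $\mathcal R^{lc}(I)$ are commutative Banach algebras with respect to pointwise multiplication and the sup-norm $\|F\|_\infty=\sup_{x\in I}|F(x)|$. (b) For $f,g\in\mathcal A_R(I)$ with respective primitives $F,G\in\mathcal R^{lc}_0(I)$, define a product by $fg=(FG)'$ (distributional derivative of the pointwise product). Then $\mathcal A_R(I)$, with the norm $\|f\|=\|F\|_\infty$, is a commutative Banach algebra. It has no unit.
   Context: Distributions: $\mathcal D$ is the space of test functions on $I$, i.e. infinitely differentiable functions $\varphi:\mathbb R\to\mathbb R$ whose support is contained in $I$; $\varphi_n\to\varphi$ in $\mathcal D$ means $\varphi_n^{(m)}\to\varphi^{(m)}$ uniformly for every $m\ge0$. $\mathcal D'$ is the space of (sequentially) continuous linear functionals on $\mathcal D$, and $\langle T',\varphi\rangle=-\langle T,\varphi'\rangle$. A Riemann integrable $H$ is identified with the distribution $\varphi\mapsto\int_IH\varphi\,dt$. A function $H:I\to\mathbb R$ is left regulated if it has a finite left limit at each point of $I$ except $\min I$. Define: - $\mathcal R^{lr}(I)$: all $H:I\to\mathbb R$ that are left regulated, Riemann integrable on $I$, and have a finite right limit at $\min I$; - $\mathcal R^{lc}(I)$: all $G\in\mathcal R^{lr}(I)$ that are left continuous on $I\setminus\{\min I\}$ and satisfy $G(\min I)=G(\min I+)$; - $\mathcal R^{lc}_0(I)=\{F\in\mathcal R^{lc}(I):F(\min I)=0\}$; - $\mathcal A_R(I)$: all $f\in\mathcal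 D'$ with $f=H'$ for some $H\in\mathcal R^{lr}(I)$. Every such $f$ has a unique primitive $F\in\mathcal R^{lc}_0(I)$ (i.e. $F'=f$). A commutative Banach algebra is a real Banach space $(V,\|\cdot\|)$ with an associative, commutative, distributive multiplication satisfying $a(uv)=(au)v$ for scalars $a$, and $\|uv\|\le\|u\|\|v\|$; no unit is required. *)

theory Defs
  imports "HOL-Analysis.Analysis"
begin

text \<open>The spaces below depend on the interval, so they are carrier sets inside a function type
  rather than types; hence the type classes for normed algebras do not apply. No unit is required.\<close>

locale real_vector_space_on =
  fixes V :: "'v set"
    and add :: "'v \<Rightarrow> 'v \<Rightarrow> 'v"
    and zero :: "'v"
    and scale :: "real \<Rightarrow> 'v \<Rightarrow> 'v"
  assumes zero_closed: "zero \<in> V"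
    and add_closed: "\<lbrakk>u \<in> V; v \<in> V\<rbrakk> \<Longrightarrow> add u v \<in> V"
    and scale_closed: "u \<in> V \<Longrightarrow> scale c u \<in> V"
    and add_assoc: "\<lbrakk>u \<in> V; v \<in> V; w \<in> V\<rbrakk> \<Longrightarrow> add (add u v) w = add u (add v w)"
    and add_comm: "\<lbrakk>u \<in> V; v \<in> V\<rbrakk> \<Longrightarrow> add u v = add v u"
    and add_zero: "u \<in> V \<Longrightarrow> add u zero = u"
    and add_inverse: "u \<in> V \<Longrightarrow> \<exists>v\<in>V. add u v = zero"
    and scale_one: "u \<in> V \<Longrightarrow> scale 1 u = u"
    and scale_scale: "u \<in> V \<Longrightarrow> scale c (scale d u) = scale (c * d) u"
    and scale_add_right: "\<lbrakk>u \<in> V; v \<in> V\<rbrakk> \<Longrightarrow> scale c (add u v) = add (scale c u) (scale c v)"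
    and scale_add_left: "u \<in> V \<Longrightarrow> scale (c + d) u = add (scale c u) (scale d u)"

locale real_banach_space_on = real_vector_space_on V add zero scale
  for V :: "'v set" and add zero scale +
  fixes nrm :: "'v \<Rightarrow> real"
  assumes norm_nonneg: "u \<in> V \<Longrightarrow> 0 \<le> nrm u"
    and norm_eq_zero: "u \<in> V \<Longrightarrow> nrm u = 0 \<longleftrightarrow> u = zero"
    and norm_scale: "u \<in> V \<Longrightarrow> nrm (scale c u) = \<bar>c\<bar> * nrm u"
    and norm_triangle: "\<lbrakk>u \<in> V; v \<in> V\<rbrakk> \<Longrightarrow> nrm (add u v) \<le> nrm u + nrm v"
    and complete:
      "\<lbrakk>\<And>n. s n \<in> V;
        \<And>e. e > 0 \<Longrightarrow> \<exists>N::nat. \<forall>m\<ge>N. \<forall>n\<ge>N. nrm (add (s m) (scale (-1) (s n))) < e\<rbrakk>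
       \<Longrightarrow> \<exists>u\<in>V. (\<lambda>n. nrm (add (s n) (scale (-1) u))) \<longlonglongrightarrow> 0"

locale comm_banach_algebra_on = real_banach_space_on V add zero scale nrm
  for V :: "'v set" and add zero scale nrm +
  fixes mult :: "'v \<Rightarrow> 'v \<Rightarrow> 'v"
  assumes mult_closed: "\<lbrakk>u \<in> V; v \<in> V\<rbrakk> \<Longrightarrow> mult u v \<in> V"
    and mult_assoc: "\<lbrakk>u \<in> V; v \<in> V; w \<in> V\<rbrakk> \<Longrightarrow> mult (mult u v) w = mult u (mult v w)"
    and mult_comm: "\<lbrakk>u \<in> V; v \<in> V\<rbrakk> \<Longrightarrow> mult u v = mult v u"
    and mult_add: "\<lbrakk>u \<in> V; v \<in> V; w \<in> V\<rbrakk> \<Longrightarrow> mult u (add v w) = add (mult u v) (mult u w)"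
    and scale_mult: "\<lbrakk>u \<in> V; v \<in> V\<rbrakk> \<Longrightarrow> scale c (mult u v) = mult (scale c u) v"
    and norm_mult: "\<lbrakk>u \<in> V; v \<in> V\<rbrakk> \<Longrightarrow> nrm (mult u v) \<le> nrm u * nrm v"

definition pw_add :: "('c \<Rightarrow> real) \<Rightarrow> ('c \<Rightarrow> real) \<Rightarrow> 'c \<Rightarrow> real" where
  "pw_add F G = (\<lambda>x. F x + G x)"

definition pw_zero :: "'c \<Rightarrow> real" where
  "pw_zero = (\<lambda>x. 0)"

definition pw_scale :: "real \<Rightarrow> ('c \<Rightarrow> real) \<Rightarrow> 'c \<Rightarrow> real" where
  "pw_scale c F = (\<lambda>x. c * F x)"

definition pw_mult :: "('c \<Rightarrow> real) \<Rightarrow> ('c \<Rightarrow> real) \<Rightarrow> 'c \<Rightarrow> real" where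
  "pw_mult F G = (\<lambda>x. F x * G x)"

text \<open>The library integral is the Henstock--Kurzweil integral. Riemann integrability asks for a
  uniform mesh; the two integrals agree on Riemann integrable functions.\<close>

definition riemann_integrable_on :: "(real \<Rightarrow> real) \<Rightarrow> real \<Rightarrow> real \<Rightarrow> bool" where
  "riemann_integrable_on f a b \<longleftrightarrow>
     (\<exists>y. \<forall>e>0. \<exists>d>0. \<forall>p. p tagged_division_of {a..b} \<and> (\<forall>(x, K)\<in>p. diameter K < d) \<longrightarrow>
        \<bar>(\<Sum>(x, K)\<in>p. measure lborel K * f x) - y\<bar> < e)"

text \<open>A function on the interval \<open>[a, b]\<close> is represented by its extension by \<open>0\<close> to the real
  line, so that equality of functions on the interval is equality in HOL. All conditions below only
  involve values in \<open>[a, b]\<close>.\<close>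

definition funs_on :: "real \<Rightarrow> real \<Rightarrow> (real \<Rightarrow> real) set" where
  "funs_on a b = {H. \<forall>x. x \<notin> {a..b} \<longrightarrow> H x = 0}"

definition left_regulated :: "real \<Rightarrow> real \<Rightarrow> (real \<Rightarrow> real) \<Rightarrow> bool" where
  "left_regulated a b H \<longleftrightarrow> (\<forall>t\<in>{a<..b}. \<exists>l. (H \<longlongrightarrow> l) (at_left t))"

definition R_lr :: "real \<Rightarrow> real \<Rightarrow> (real \<Rightarrow> real) set" where
  "R_lr a b = {H \<in> funs_on a b. left_regulated a b H \<and> riemann_integrable_on H a b \<and>
                 (\<exists>l. (H \<longlongrightarrow> l) (at_right a))}"

definition R_lc :: "real \<Rightarrow> real \<Rightarrow> (real \<Rightarrow> real) set" where
  "R_lc a b = {G \<in> R_lr a b. (\<forall>t\<in>{a<..b}. (G \<longlongrightarrow> G t) (at_left t)) \<and> (G \<longlongrightarrow> G a) (at_right a)}"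

definition R_lc0 :: "real \<Rightarrow> real \<Rightarrow> (real \<Rightarrow> real) set" where
  "R_lc0 a b = {F \<in> R_lc a b. F a = 0}"

definition sup_norm :: "real \<Rightarrow> real \<Rightarrow> (real \<Rightarrow> real) \<Rightarrow> real" where
  "sup_norm a b F = (SUP x\<in>{a..b}. \<bar>F x\<bar>)"

definition test_funs :: "real \<Rightarrow> real \<Rightarrow> (real \<Rightarrow> real) set" where
  "test_funs a b = {\<phi>. (\<forall>m x. (deriv ^^ m) \<phi> differentiable (at x)) \<and>
                        closure {x. \<phi> x \<noteq> 0} \<subseteq> {a..b}}"

definition test_converges :: "(nat \<Rightarrow> real \<Rightarrow> real) \<Rightarrow> (real \<Rightarrow> real) \<Rightarrow> bool" where
  "test_converges \<phi> \<psi> \<longleftrightarrow>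
     (\<forall>m. uniform_limit UNIV (\<lambda>n. (deriv ^^ m) (\<phi> n)) ((deriv ^^ m) \<psi>) sequentially)"

text \<open>A functional on the test functions is represented by its extension by \<open>0\<close> to all functions,
  so that equality of distributions is equality in HOL.\<close>

definition distributions :: "real \<Rightarrow> real \<Rightarrow> ((real \<Rightarrow> real) \<Rightarrow> real) set" where
  "distributions a b = {T.
     (\<forall>\<phi>. \<phi> \<notin> test_funs a b \<longrightarrow> T \<phi> = 0) \<and>
     (\<forall>\<phi>\<in>test_funs a b. \<forall>\<psi>\<in>test_funs a b. T (\<lambda>x. \<phi> x + \<psi> x) = T \<phi> + T \<psi>) \<and>
     (\<forall>c. \<forall>\<phi>\<in>test_funs a b. T (\<lambda>x. c * \<phi> x) = c * T \<phi>) \<and>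
     (\<forall>\<phi> \<psi>. (\<forall>n. \<phi> n \<in> test_funs a b) \<and> \<psi> \<in> test_funs a b \<and> test_converges \<phi> \<psi> \<longrightarrow>
        (\<lambda>n. T (\<phi> n)) \<longlonglongrightarrow> T \<psi>)}"

definition dist_of_fun :: "real \<Rightarrow> real \<Rightarrow> (real \<Rightarrow> real) \<Rightarrow> (real \<Rightarrow> real) \<Rightarrow> real" where
  "dist_of_fun a b H = (\<lambda>\<phi>. if \<phi> \<in> test_funs a b then integral {a..b} (\<lambda>t. H t * \<phi> t) else 0)"

definition dist_deriv ::
    "real \<Rightarrow> real \<Rightarrow> ((real \<Rightarrow> real) \<Rightarrow> real) \<Rightarrow> (real \<Rightarrow> real) \<Rightarrow> real" where
  "dist_deriv a b T = (\<lambda>\<phi>. if \<phi> \<in> test_funs a b then - T (deriv \<phi>) else 0)"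

definition A_R :: "real \<Rightarrow> real \<Rightarrow> ((real \<Rightarrow> real) \<Rightarrow> real) set" where
  "A_R a b = {f \<in> distributions a b. \<exists>H\<in>R_lr a b. f = dist_deriv a b (dist_of_fun a b H)}"

text \<open>For nondegenerate \<open>[a, b]\<close>, every element of \<open>A_R a b\<close> has exactly one primitive in
  \<open>R_lc0 a b\<close>, so the definite description is meaningful.\<close>

definition primitive :: "real \<Rightarrow> real \<Rightarrow> ((real \<Rightarrow> real) \<Rightarrow> real) \<Rightarrow> real \<Rightarrow> real" where
  "primitive a b f = (THE F. F \<in> R_lc0 a b \<and> dist_deriv a b (dist_of_fun a b F) = f)"

definition A_R_mult ::
    "real \<Rightarrow> real \<Rightarrow> ((real \<Rightarrow> real) \<Rightarrow> real) \<Rightarrow> ((real \<Rightarrow> real) \<Rightarrow> real) \<Rightarrow> (real \<Rightarrow> real) \<Rightarrow> real" where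
  "A_R_mult a b f g =
     dist_deriv a b (dist_of_fun a b (pw_mult (primitive a b f) (primitive a b g)))"

definition A_R_norm :: "real \<Rightarrow> real \<Rightarrow> ((real \<Rightarrow> real) \<Rightarrow> real) \<Rightarrow> real" where
  "A_R_norm a b f = sup_norm a b (primitive a b f)"

end

theory Submission
  imports Defs
begin

text \<open>
A function with left limits everywhere on \<open>(a, b]\<close> has at most countably many discontinuities
(\<open>countable_discontinuities_if_left_limits\<close>). Together with dominated convergence for the step
functions behind Riemann sums, this shows that a left regulated function is Riemann integrable
exactly if it is bounded (\<open>riemann_integrable_iff_bounded_if_left_regulated\<close>). So \<open>R_lc a b\<close> consists
of the bounded functions that are left continuous on \<open>(a, b]\<close> and right continuous at \<open>a\<close>, and these
conditions are preserved by sums, products and uniform limits, as is vanishing at \<open>a\<close>. This gives the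
two Banach algebras of functions.

The algebra of distributions is a copy of \<open>R_lc0 a b\<close>: the map \<open>dist_deriv_fun\<close> that sends \<open>F\<close> to its
distributional derivative is a linear bijection onto \<open>A_R a b\<close> (\<open>dist_deriv_fun_bij\<close>), and product and
norm are defined by pulling back along it. It is onto because replacing the values of a function by
its left limits affects only countably many points, hence no integral, and because constants have
derivative zero. It is injective by a du Bois-Reymond argument: for \<open>a < c < d \<le> b\<close>, the difference of
a smooth step from \<open>0\<close> to \<open>1\<close> just left of \<open>c\<close> and one just left of \<open>d\<close> is a test function. If \<open>F\<close> has
derivative zero, then testing against such differences equates averages of \<open>F\<close> just left of \<open>c\<close> and of
\<open>d\<close>, so \<open>F(c) = F(d)\<close> by left continuity. The required smooth step is the antiderivative of a bump built from
\<open>exp(-1/x)\<close>.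

There is no unit because the primitive of a unit would have to equal \<open>1\<close> to the right of \<open>a\<close> and yet
tend to \<open>0\<close> at \<open>a\<close>.
\<close>

section \<open>Riemann integrability of left regulated functions\<close>

text \<open>A left limit at \<open>t\<close> keeps the oscillation of \<open>H\<close> small on some interval \<open>(t - d, t)\<close>. Hence the
points at which the oscillation is at least \<open>1/(n+1)\<close> are isolated from the left, and a set of
reals with that property is countable because disjoint left neighbourhoods of its points contain
different rationals.\<close>

lemma countable_discontinuities_if_left_limits:
  assumes "left_regulated a b H"
  shows "countable {x \<in> {a<..<b}. \<not> isCont H x}"
proof -
  \<comment> \<open>The points of oscillation at least \<open>1/(n+1)\<close>.\<close>
  define D where "D n = {x \<in> {a<..<b}. \<forall>d>0. \<exists>y\<in>ball x d. \<exists>z\<in>ball x d. \<bar>H y - H z\<bar> \<ge> 1 / Suc n}"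
    for n
  have "countable (D n)" for n
  proof -
    have "\<exists>d>0. {t - d<..<t} \<inter> D n = {}" if t: "t \<in> {a<..b}" for t
    proof -
      from assms t obtain l where l: "(H \<longlongrightarrow> l) (at_left t)"
        unfolding left_regulated_def by blast
      define c where "c = 1 / (2 * real (Suc n))"
      have c: "0 < c" "1 / real (Suc n) = 2 * c" by (simp_all add: c_def field_simps)
      have "eventually (\<lambda>y. dist (H y) l < c) (at_left t)"
        using l c(1) by (rule tendstoD)
      then obtain s where s: "s < t" "\<And>y. y \<in> {s<..<t} \<Longrightarrow> dist (H y) l < c"
        by (auto simp: eventually_at_left_field)
      have "{s<..<t} \<inter> D n = {}"
      proof (rule ccontr)
        assume "\<not> ?thesis"
        then obtain x where x: "x \<in> {s<..<t}" "x \<in> D n" by blast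
        have "open {s<..<t}" by simp
        with x(1) obtain d where d: "d > 0" "ball x d \<subseteq> {s<..<t}"
          unfolding open_contains_ball by blast
        from x(2) d(1) obtain y z where "y \<in> ball x d" "z \<in> ball x d" "\<bar>H y - H z\<bar> \<ge> 1 / Suc n"
          by (auto simp: D_def)
        then have "dist (H y) l < c" "dist (H z) l < c" "\<bar>H y - H z\<bar> \<ge> 2 * c"
          using s(2) d(2) unfolding c(2) by blast+
        then show False by (simp add: dist_real_def)
      qed
      then show ?thesis using s(1) by (intro exI[of _ "t - s"]) auto
    qed
    then obtain d where d: "\<And>t. t \<in> {a<..b} \<Longrightarrow> d t > 0 \<and> {t - d t<..<t} \<inter> D n = {}"
      by metis
    have "\<exists>q\<in>\<rat>. t - d t < q \<and> q < t" if "t \<in> D n" for t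
      using Rats_dense_in_real[of "t - d t" t] d[of t] that by (auto simp: D_def)
    then obtain q where q: "\<And>t. t \<in> D n \<Longrightarrow> q t \<in> \<rat> \<and> t - d t < q t \<and> q t < t"
      by metis
    \<comment> \<open>A common rational of two left neighbourhoods would put the smaller point inside the neighbourhood of the larger one.\<close>
    have less: "q t \<noteq> q t'" if "t \<in> D n" "t' \<in> D n" "t < t'" for t t'
    proof
      assume "q t = q t'"
      then have "t \<in> {t' - d t'<..<t'}" using q[OF that(1)] q[OF that(2)] that(3) by auto
      then show False using d[of t'] that by (auto simp: D_def)
    qed
    have "inj_on q (D n)"
      by (rule inj_onI) (metis less linorder_neqE_linordered_idom)
    moreover have "countable (q ` D n)"
      using q by (intro countable_subset[OF _ countable_rat]) auto
    ultimately show ?thesis by (rule countable_image_inj_on[rotated])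
  qed
  then have "countable (\<Union>n. D n)" by auto
  moreover have "{x \<in> {a<..<b}. \<not> isCont H x} \<subseteq> (\<Union>n. D n)"
  proof (rule subsetI, rule ccontr)
    fix x assume x: "x \<in> {x \<in> {a<..<b}. \<not> isCont H x}" and "x \<notin> (\<Union>n. D n)"
    then have n: "x \<notin> D n" for n by auto
    have "isCont H x"
      unfolding continuous_at_eps_delta
    proof (intro allI impI)
      fix e :: real assume "e > 0"
      then obtain n where n_e: "1 / Suc n < e" using nat_approx_posE by metis
      from n[of n] x obtain d where d: "d > 0"
        "\<And>y z. y \<in> ball x d \<Longrightarrow> z \<in> ball x d \<Longrightarrow> \<bar>H y - H z\<bar> < 1 / Suc n"
        by (auto simp: D_def not_le)
      then have "\<bar>H x' - H x\<bar> < e" if "dist x' x < d" for x'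
        using less_trans[OF d(2) n_e, of x' x] d(1) that by (simp add: dist_commute)
      with d(1) show "\<exists>d>0. \<forall>x'. dist x' x < d \<longrightarrow> dist (H x') (H x) < e"
        unfolding dist_real_def by blast
    qed
    with x show False by simp
  qed
  ultimately show ?thesis by (rule countable_subset[rotated])
qed

text \<open>Realises a Riemann sum as the integral of a step function, so that convergence theorems for
integrals apply to Riemann sums. The finite exceptional set \<open>E\<close> consists of the endpoints of the
pieces, where several pieces overlap.\<close>

lemma step_function_of_tagged_division:
  fixes f :: "real \<Rightarrow> real"
  assumes p: "p tagged_division_of {a..b}"
  obtains E where "finite E"
    "((\<lambda>x. \<Sum>(t, K)\<in>p. if x \<in> K then f t else 0) has_integral
        (\<Sum>(t, K)\<in>p. measure lborel K * f t)) {a..b}"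
    "\<And>x. x \<in> {a..b} - E \<Longrightarrow>
       \<exists>(t, K)\<in>p. x \<in> K \<and> (\<Sum>(t, K)\<in>p. if x \<in> K then f t else 0) = f t"
proof -
  define E where "E = (\<Union>(t, K)\<in>p. frontier K)"
  note pD = tagged_division_ofD[OF p]
  have "finite (frontier K)" if tK: "(t, K) \<in> p" for t K
  proof -
    obtain u v where K: "K = cbox u v" using pD(4)[OF tK] by blast
    have "frontier K \<subseteq> {u, v}" unfolding K frontier_cbox by auto
    then show ?thesis by (rule finite_subset) auto
  qed
  then have "finite E" using pD(1) by (auto simp: E_def)
  moreover have "((\<lambda>x. \<Sum>(t, K)\<in>p. if x \<in> K then f t else 0) has_integral
        (\<Sum>(t, K)\<in>p. measure lborel K * f t)) {a..b}"
    unfolding case_prod_unfold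
  proof (rule has_integral_sum[OF pD(1)])
    fix tK assume tK: "tK \<in> p"
    obtain t K where eq: "tK = (t, K)" by (cases tK)
    with tK have tK': "(t, K) \<in> p" by simp
    obtain u v where K: "K = cbox u v" using pD(4)[OF tK'] by auto
    have "((\<lambda>x. f t) has_integral measure lborel K * f t) K"
      using has_integral_const[of "f t" u v] by (simp add: K)
    then have "((\<lambda>x. if x \<in> K then f t else 0) has_integral measure lborel K * f t) {a..b}"
      using pD(3)[OF tK'] by (subst has_integral_restrict)
    then show "((\<lambda>x. if x \<in> snd tK then f (fst tK) else 0) has_integral
                 measure lborel (snd tK) * f (fst tK)) {a..b}" unfolding eq prod.sel .
  qed
  moreover have "\<exists>(t, K)\<in>p. x \<in> K \<and> (\<Sum>(t, K)\<in>p. if x \<in> K then f t else 0) = f t"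
    if x: "x \<in> {a..b} - E" for x
  proof -
    have "x \<in> \<Union>{K. \<exists>t. (t, K) \<in> p}" using x pD(6) by blast
    then obtain t K where tK: "(t, K) \<in> p" "x \<in> K" by blast
    have int: "x \<in> interior K'" if "(t', K') \<in> p" "x \<in> K'" for t' K'
      using x that closure_subset[of K'] by (auto simp: E_def frontier_def)
    have "(if x \<in> K' then f t' else 0) = 0" if "(t', K') \<in> p - {(t, K)}" for t' K'
      using int[of t K] int[of t' K'] pD(5)[of t K t' K'] tK that by auto
    then have "(\<Sum>(t, K)\<in>p. if x \<in> K then f t else 0) = f t"
      using pD(1) tK by (subst sum.remove[of _ "(t, K)"]) (auto intro!: sum.neutral)
    with tK show ?thesis by auto
  qed
  ultimately show ?thesis using that by blast
qed

lemma negligible_if_countable: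
  fixes N :: "real set"
  assumes "countable N"
  shows "negligible N"
  using negligible_countable_Union[of "(\<lambda>x. {x}) ` N"] assms by auto

text \<open>The half of Lebesgue's criterion that is used below, for countably many discontinuities. If it
failed, there would be tagged divisions of mesh below \<open>1/(n+1)\<close> whose Riemann sums stay away from
the integral. Their step functions are uniformly bounded and converge to \<open>f\<close> at every point of
continuity outside the countably many endpoints, since the tag next to \<open>x\<close> tends to \<open>x\<close>; dominated
convergence contradicts the gap.\<close>

lemma riemann_integrable_on_if_countable_discontinuities:
  fixes f :: "real \<Rightarrow> real"
  assumes bdd: "bounded (f ` {a..b})" and D: "countable {x \<in> {a<..<b}. \<not> isCont f x}"
  shows "riemann_integrable_on f a b"
proof (rule ccontr)
  assume "\<not> riemann_integrable_on f a b"
  define rsum where "rsum p = (\<Sum>(x, K)\<in>p. measure lborel K * f x)" for p :: "(real \<times> real set) set"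
  define mesh_less where "mesh_less p d \<longleftrightarrow> p tagged_division_of {a..b} \<and> (\<forall>(x, K)\<in>p. diameter K < d)"
    for p d
  from \<open>\<not> riemann_integrable_on f a b\<close>
  have "\<not> (\<forall>e>0. \<exists>d>0. \<forall>p. mesh_less p d \<longrightarrow> \<bar>rsum p - integral {a..b} f\<bar> < e)"
    unfolding riemann_integrable_on_def rsum_def mesh_less_def by blast
  then obtain e where e: "e > 0"
    "\<And>d. d > 0 \<Longrightarrow> \<exists>p. mesh_less p d \<and> \<not> \<bar>rsum p - integral {a..b} f\<bar> < e"
    by blast
  have "\<forall>n. \<exists>p. mesh_less p (1 / Suc n) \<and> \<not> \<bar>rsum p - integral {a..b} f\<bar> < e"
    by (intro allI e(2)) simp
  then obtain p where "\<forall>n. mesh_less (p n) (1 / Suc n) \<and> \<not> \<bar>rsum (p n) - integral {a..b} f\<bar> < e"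
    unfolding choice_iff by blast
  then have p: "\<And>n. p n tagged_division_of {a..b}"
    "\<And>n x K. (x, K) \<in> p n \<Longrightarrow> diameter K < 1 / Suc n"
    "\<And>n. \<not> \<bar>(\<Sum>(x, K)\<in>p n. measure lborel K * f x) - integral {a..b} f\<bar> < e"
    by (auto simp: mesh_less_def rsum_def)
  define g where "g n x = (\<Sum>(t, K)\<in>p n. if x \<in> K then f t else 0)" for n x
  have "\<forall>n. \<exists>E. finite E \<and> (g n has_integral (\<Sum>(t, K)\<in>p n. measure lborel K * f t)) {a..b} \<and>
      (\<forall>x\<in>{a..b} - E. \<exists>(t, K)\<in>p n. x \<in> K \<and> g n x = f t)"
  proof
    fix n
    show "\<exists>E. finite E \<and> (g n has_integral (\<Sum>(t, K)\<in>p n. measure lborel K * f t)) {a..b} \<and>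
      (\<forall>x\<in>{a..b} - E. \<exists>(t, K)\<in>p n. x \<in> K \<and> g n x = f t)"
      unfolding g_def by (rule step_function_of_tagged_division[OF p(1)[of n], where f = f]) blast
  qed
  then obtain E where "\<forall>n. finite (E n) \<and>
      (g n has_integral (\<Sum>(t, K)\<in>p n. measure lborel K * f t)) {a..b} \<and>
      (\<forall>x\<in>{a..b} - E n. \<exists>(t, K)\<in>p n. x \<in> K \<and> g n x = f t)"
    unfolding choice_iff by blast
  then have E: "\<And>n. finite (E n)"
    "\<And>n. (g n has_integral (\<Sum>(t, K)\<in>p n. measure lborel K * f t)) {a..b}"
    "\<And>n x. x \<in> {a..b} - E n \<Longrightarrow> \<exists>(t, K)\<in>p n. x \<in> K \<and> g n x = f t"
    by auto
  define N where "N = (\<Union>n. E n) \<union> {x \<in> {a<..<b}. \<not> isCont f x} \<union> {a, b}"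
  have "countable N" using E(1) D by (auto simp: N_def countable_finite)
  then have N: "negligible N" by (rule negligible_if_countable)
  define S where "S = {a..b} - N"
  have spike: "(h has_integral y) {a..b} \<longleftrightarrow> (h has_integral y) S" for h :: "real \<Rightarrow> real" and y
    by (rule has_integral_spike_set_eq) (auto simp: S_def intro: negligible_subset[OF N])
  from bdd obtain B where "\<forall>y\<in>f ` {a..b}. norm y \<le> B" unfolding bounded_iff by blast
  then have B: "\<And>x. x \<in> {a..b} \<Longrightarrow> \<bar>f x\<bar> \<le> B" by auto
  have tag: "\<exists>t. t \<in> {a..b} \<and> \<bar>t - x\<bar> < 1 / Suc n \<and> g n x = f t" if "x \<in> S" for n x
  proof -
    have "x \<in> {a..b} - E n" using that by (auto simp: S_def N_def)
    from E(3)[OF this] obtain t K where tK: "(t, K) \<in> p n" "x \<in> K" "g n x = f t" by auto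
    note pD = tagged_division_ofD[OF p(1)[of n]]
    have "bounded K" using pD(4)[OF tK(1)] by auto
    then have "dist t x \<le> diameter K" using pD(2)[OF tK(1)] tK(2) by (rule diameter_bounded_bound)
    then show ?thesis using pD(2,3)[OF tK(1)] p(2)[OF tK(1)] tK
      by (intro exI[of _ t]) (auto simp: dist_real_def)
  qed
  have "(\<lambda>n. integral S (g n)) \<longlonglongrightarrow> integral S f"
  proof (rule dominated_convergence(2)[where h = "\<lambda>x. B"])
    show "g n integrable_on S" for n using E(2)[of n] spike by (auto simp: integrable_on_def)
    show "(\<lambda>x. B) integrable_on S" using spike[of "\<lambda>x. B"] integrable_const_ivl[of B a b]
      by (auto simp: integrable_on_def)
    show "norm (g n x) \<le> B" if "x \<in> S" for n x
      using tag[OF that, of n] B by auto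
    show "(\<lambda>n. g n x) \<longlonglongrightarrow> f x" if xS: "x \<in> S" for x
    proof -
      obtain t where t: "\<And>n. \<bar>t n - x\<bar> < 1 / Suc n" "\<And>n. g n x = f (t n)"
        using tag[OF xS] by metis
      have "(\<lambda>n. 1 / real (Suc n)) \<longlonglongrightarrow> 0" by (rule LIMSEQ_Suc[OF lim_1_over_n])
      then have "(\<lambda>n. \<bar>t n - x\<bar>) \<longlonglongrightarrow> 0"
        by (rule tendsto_sandwich[OF _ _ tendsto_const, rotated 2])
          (use t(1) in \<open>auto intro!: always_eventually less_imp_le simp del: of_nat_Suc\<close>)
      then have "(\<lambda>n. t n - x) \<longlonglongrightarrow> 0" by (rule tendsto_rabs_zero_cancel)
      then have "t \<longlonglongrightarrow> x" by (simp add: LIM_zero_iff)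
      moreover have "isCont f x" using xS by (auto simp: S_def N_def)
      ultimately show ?thesis unfolding t(2) by (rule isCont_tendsto_compose[rotated])
    qed
  qed
  moreover have "integral S h = integral {a..b} h" for h :: "real \<Rightarrow> real"
    using spike[of h] by (simp add: integral_def integrable_on_def)
  moreover have "integral {a..b} (g n) = (\<Sum>(t, K)\<in>p n. measure lborel K * f t)" for n
    using E(2) by (rule integral_unique)
  ultimately have "(\<lambda>n. (\<Sum>(t, K)\<in>p n. measure lborel K * f t)) \<longlonglongrightarrow> integral {a..b} f"
    by simp
  from tendstoD[OF this e(1)] have "eventually (\<lambda>n. False) sequentially"
    using p(3) by (auto simp: dist_real_def)
  then show False by simp
qed

lemma diameter_less_if_fine:
  fixes x :: real
  assumes "d > 0" "(\<lambda>x. ball x (d/4)) fine p" "(x, K) \<in> p"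
  shows "diameter K < d"
proof -
  have "K \<subseteq> ball x (d/4)" using assms(2,3) by (auto simp: fine_def)
  then have "diameter K \<le> diameter (ball x (d/4))" by (rule diameter_subset) auto
  also have "\<dots> < d" using assms(1) by simp
  finally show ?thesis .
qed

lemma integrable_on_if_riemann_integrable:
  assumes "riemann_integrable_on f a b"
  shows "f integrable_on {a..b}"
proof -
  obtain y where y: "\<And>e. e > 0 \<Longrightarrow>
     \<exists>d>0. \<forall>p. p tagged_division_of {a..b} \<and> (\<forall>(x, K)\<in>p. diameter K < d) \<longrightarrow>
        \<bar>(\<Sum>(x, K)\<in>p. measure lborel K * f x) - y\<bar> < e"
    using assms by (auto simp: riemann_integrable_on_def)
  have "(f has_integral y) {a..b}"
    unfolding has_integral_real
  proof (intro allI impI)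
    fix e :: real assume "e > 0"
    from y[OF this] obtain d where d: "d > 0"
      "\<And>p. p tagged_division_of {a..b} \<Longrightarrow> (\<forall>(x, K)\<in>p. diameter K < d) \<Longrightarrow>
        \<bar>(\<Sum>(x, K)\<in>p. measure lborel K * f x) - y\<bar> < e" by blast
    show "\<exists>\<gamma>. gauge \<gamma> \<and> (\<forall>\<D>. \<D> tagged_division_of {a..b} \<and> \<gamma> fine \<D> \<longrightarrow>
          norm ((\<Sum>(x, k)\<in>\<D>. measure lborel k *\<^sub>R f x) - y) < e)"
      using d(1) diameter_less_if_fine[OF d(1)]
      by (intro exI[of _ "\<lambda>x. ball x (d/4)"]) (auto intro!: gauge_ball_dependent d(2))
  qed
  then show ?thesis by auto
qed

text \<open>In a fine tagged division, moving a single tag inside its piece \<open>K\<close> changes the Riemann sum by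
less than \<open>2\<close>. So on \<open>K\<close> the values of \<open>f\<close> differ from the value at the tag by less than \<open>2\<close> over the
length of \<open>K\<close>, and there are finitely many pieces.\<close>

lemma bounded_if_riemann_integrable:
  assumes "riemann_integrable_on f a b"
  shows "bounded (f ` {a..b})"
proof -
  obtain y d where d: "d > 0"
    "\<And>p. p tagged_division_of {a..b} \<Longrightarrow> (\<forall>(x, K)\<in>p. diameter K < d) \<Longrightarrow>
        \<bar>(\<Sum>(x, K)\<in>p. measure lborel K * f x) - y\<bar> < 1"
    using assms zero_less_one unfolding riemann_integrable_on_def by metis
  obtain p where p: "p tagged_division_of {a..b}" "(\<lambda>x. ball x (d/4)) fine p"
    using fine_division_exists_real[of "\<lambda>x. ball x (d/4)" a b] d(1) gauge_ball_dependent[of "\<lambda>x. d/4"]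
    by auto
  note pD = tagged_division_ofD[OF p(1)]
  have diam: "diameter K < d" if "(x, K) \<in> p" for x K
    using d(1) p(2) that by (rule diameter_less_if_fine)
  have "bounded (f ` K)" if tK: "(t, K) \<in> p" for t K
  proof -
    obtain u v where K: "K = cbox u v" using pD(4)[OF tK] by auto
    have tinK: "t \<in> K" using pD(2)[OF tK] .
    show ?thesis
    proof (cases "u < v")
      case False
      \<comment> \<open>A degenerate piece contributes nothing to the sum, but it is a single point.\<close>
      then have "K = {t}" using tinK by (auto simp: K)
      then show ?thesis by simp
    next
      case True
      define c where "c = measure lborel K"
      have c: "c > 0" using True by (simp add: c_def K)
      have ne: "interior K \<noteq> {}" using True by (simp add: K)
      have "\<bar>f x\<bar> \<le> \<bar>f t\<bar> + 2 / c" if x: "x \<in> K" for x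
      proof -
        define p' where "p' = insert (x, K) (p - {(t, K)})"
        have dis: "interior K \<inter> interior K' = {}" if "(t', K') \<in> p - {(t, K)}" for t' K'
          using pD(5)[of t K t' K'] tK that by auto
        then have notin: "(s, K) \<notin> p - {(t, K)}" for s using ne by blast
        have "p' tagged_division_of {a..b}"
        proof (rule tagged_division_ofI)
          show "finite p'" using pD(1) by (simp add: p'_def)
          show "s \<in> L" "L \<subseteq> {a..b}" "\<exists>a b. L = cbox a b" if "(s, L) \<in> p'" for s L
            using that pD(2-4)[of s L] pD(2-4)[OF tK] x by (auto simp: p'_def split: if_splits)
          show "interior L \<inter> interior L' = {}" if "(s, L) \<in> p'" "(s', L') \<in> p'" "(s, L) \<noteq> (s', L')"
            for s L s' L'
            using that pD(5)[of s L s' L'] dis[of s L] dis[of s' L'] by (auto simp: p'_def)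
          have "{K. \<exists>x. (x, K) \<in> p'} = {K. \<exists>x. (x, K) \<in> p}" using tK by (auto simp: p'_def)
          then show "\<Union> {K. \<exists>x. (x, K) \<in> p'} = {a..b}" using pD(6) by simp
        qed
        moreover have "\<forall>(x, K)\<in>p'. diameter K < d" using diam tK by (auto simp: p'_def)
        ultimately have "\<bar>(\<Sum>(x, K)\<in>p'. measure lborel K * f x) - y\<bar> < 1" by (rule d(2))
        moreover have "\<bar>(\<Sum>(x, K)\<in>p. measure lborel K * f x) - y\<bar> < 1"
          using p(1) diam by (intro d(2)) auto
        moreover have "(\<Sum>(x, K)\<in>p'. measure lborel K * f x) =
            c * f x + (\<Sum>(x, K)\<in>p - {(t, K)}. measure lborel K * f x)"
          using pD(1) notin by (simp add: p'_def c_def)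
        moreover have "(\<Sum>(x, K)\<in>p. measure lborel K * f x) =
            c * f t + (\<Sum>(x, K)\<in>p - {(t, K)}. measure lborel K * f x)"
          using pD(1) tK by (simp add: c_def sum.remove[of p "(t, K)"])
        ultimately have "\<bar>c * f x - c * f t\<bar> < 2" by linarith
        moreover have "\<bar>c * f x - c * f t\<bar> = c * \<bar>f x - f t\<bar>"
          using c by (simp add: abs_mult flip: right_diff_distrib)
        ultimately have "\<bar>f x - f t\<bar> < 2 / c" using c by (simp add: field_simps)
        then show ?thesis by linarith
      qed
      then show ?thesis by (auto simp: bounded_iff)
    qed
  qed
  then have "bounded (\<Union>(t, K)\<in>p. f ` K)" using pD(1) by (intro bounded_UN) auto
  moreover have "f ` {a..b} \<subseteq> (\<Union>(t, K)\<in>p. f ` K)" using pD(6) by fastforce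
  ultimately show ?thesis by (rule bounded_subset)
qed

text \<open>With this equivalence, closure under products and uniform limits becomes a matter of bounds and
one-sided limits, without Riemann sums.\<close>

lemma riemann_integrable_iff_bounded_if_left_regulated:
  assumes "left_regulated a b H"
  shows "riemann_integrable_on H a b \<longleftrightarrow> bounded (H ` {a..b})"
  using bounded_if_riemann_integrable
    riemann_integrable_on_if_countable_discontinuities[OF _ countable_discontinuities_if_left_limits[OF assms]]
  by blast

section \<open>The Banach algebras of left continuous functions\<close>

lemma abs_le_sup_norm:
  assumes "bounded (F ` {a..b})" "x \<in> {a..b}"
  shows "\<bar>F x\<bar> \<le> sup_norm a b F"
proof -
  from assms(1) obtain B where "\<forall>y\<in>F ` {a..b}. norm y \<le> B" unfolding bounded_iff by blast
  then have "bdd_above ((\<lambda>x. \<bar>F x\<bar>) ` {a..b})" by (intro bdd_aboveI[of _ B]) auto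
  then show ?thesis unfolding sup_norm_def using assms(2) by (rule cSUP_upper[rotated])
qed

lemma sup_norm_le:
  assumes "a \<le> b" "\<And>x. x \<in> {a..b} \<Longrightarrow> \<bar>F x\<bar> \<le> c"
  shows "sup_norm a b F \<le> c"
  unfolding sup_norm_def using assms by (intro cSUP_least) auto

lemma R_lr_bounded:
  assumes "H \<in> R_lr a b"
  shows "bounded (H ` {a..b})"
  using assms bounded_if_riemann_integrable by (auto simp: R_lr_def)

lemma R_lc_iff_bounded:
  "G \<in> R_lc a b \<longleftrightarrow> G \<in> funs_on a b \<and> bounded (G ` {a..b}) \<and>
     (\<forall>t\<in>{a<..b}. (G \<longlongrightarrow> G t) (at_left t)) \<and> (G \<longlongrightarrow> G a) (at_right a)"
proof -
  have "left_regulated a b G" if "\<forall>t\<in>{a<..b}. (G \<longlongrightarrow> G t) (at_left t)"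
    using that by (auto simp: left_regulated_def)
  then show ?thesis
    using riemann_integrable_iff_bounded_if_left_regulated[of a b G]
    unfolding R_lc_def R_lr_def by blast
qed

lemma R_lc_bounded: "F \<in> R_lc a b \<Longrightarrow> bounded (F ` {a..b})"
  by (simp add: R_lc_iff_bounded)

lemma bounded_image_real_iff: "bounded (F ` S) \<longleftrightarrow> (\<exists>B. \<forall>x\<in>S. \<bar>F x :: real\<bar> \<le> B)"
  by (auto simp: bounded_iff)

lemma R_lc_zero: "pw_zero \<in> R_lc a b"
  by (auto simp: R_lc_iff_bounded pw_zero_def funs_on_def bounded_image_real_iff)

lemma R_lc_add: 
  assumes "F \<in> R_lc a b" "G \<in> R_lc a b"
  shows "pw_add F G \<in> R_lc a b"
  using assms bounded_plus_comp[of F "{a..b}" G]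
  by (auto simp: R_lc_iff_bounded pw_add_def funs_on_def intro!: tendsto_add)

lemma R_lc_mult: 
  assumes "F \<in> R_lc a b" "G \<in> R_lc a b"
  shows "pw_mult F G \<in> R_lc a b"
proof -
  obtain B C where "\<forall>x\<in>{a..b}. \<bar>F x\<bar> \<le> B" "\<forall>x\<in>{a..b}. \<bar>G x\<bar> \<le> C"
    using assms by (auto simp: R_lc_iff_bounded bounded_image_real_iff)
  then have "\<bar>F x * G x\<bar> \<le> B * C" if "x \<in> {a..b}" for x
    unfolding abs_mult using that by (intro mult_mono') auto
  then have "bounded ((\<lambda>x. F x * G x) ` {a..b})" unfolding bounded_image_real_iff by blast
  then show ?thesis using assms
    by (auto simp: R_lc_iff_bounded pw_mult_def funs_on_def intro!: tendsto_mult)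
qed

lemma R_lc_scale: 
  assumes "F \<in> R_lc a b"
  shows "pw_scale c F \<in> R_lc a b"
  using assms bounded_scaling[of "F ` {a..b}" c]
  by (auto simp: R_lc_iff_bounded pw_scale_def funs_on_def image_image intro!: tendsto_mult_left)

text \<open>Completeness rests on this: one-sided limits may be interchanged with uniform limits.\<close>

lemma R_lc_uniform_limit:
  assumes s: "\<And>n. s n \<in> R_lc a b" and lim: "uniform_limit UNIV s G sequentially"
  shows "G \<in> R_lc a b"
proof -
  have pw: "(\<lambda>n. s n x) \<longlonglongrightarrow> G x" for x using lim by (rule tendsto_uniform_limitI) simp
  have "G \<in> funs_on a b"
  proof -
    have "G x = 0" if "x \<notin> {a..b}" for x
      using pw[of x] s that by (auto simp: R_lc_iff_bounded funs_on_def LIMSEQ_const_iff)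
    then show ?thesis by (simp add: funs_on_def)
  qed
  moreover have "bounded (G ` {a..b})"
  proof -
    obtain N where N: "\<And>x. dist (s N x) (G x) < 1"
      using uniform_limitD[OF lim zero_less_one] by (auto simp: eventually_sequentially)
    obtain B where B: "\<And>x. x \<in> {a..b} \<Longrightarrow> \<bar>s N x\<bar> \<le> B"
      using s[of N] by (metis R_lc_iff_bounded bounded_image_real_iff)
    have "\<bar>G x\<bar> \<le> B + 1" if "x \<in> {a..b}" for x
      using N[of x] B[OF that] by (simp add: dist_real_def)
    then show ?thesis unfolding bounded_image_real_iff by blast
  qed
  moreover have "(G \<longlongrightarrow> G t) F" if "\<And>n. (s n \<longlongrightarrow> s n t) F" for t F
    by (rule swap_uniform_limit'[OF always_eventually pw lim]) (use that in auto)
  ultimately show ?thesis using s by (simp add: R_lc_iff_bounded)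
qed

text \<open>Treats both function spaces at once. Functions in \<open>R_lc a b\<close> vanish outside \<open>[a, b]\<close>, so a Cauchy
sequence in the sup-norm is uniformly Cauchy on the whole line.\<close>

lemma comm_banach_algebra_on_R_lc_closed_subalgebra:
  assumes "a < b" and sub: "V \<subseteq> R_lc a b"
    and zero: "pw_zero \<in> V"
    and add: "\<And>F G. F \<in> V \<Longrightarrow> G \<in> V \<Longrightarrow> pw_add F G \<in> V"
    and scale: "\<And>c F. F \<in> V \<Longrightarrow> pw_scale c F \<in> V"
    and mult: "\<And>F G. F \<in> V \<Longrightarrow> G \<in> V \<Longrightarrow> pw_mult F G \<in> V"
    and closed: "\<And>s G. (\<And>n. s n \<in> V) \<Longrightarrow> G \<in> R_lc a b \<Longrightarrow> (\<And>x. (\<lambda>n. s n x) \<longlonglongrightarrow> G x) \<Longrightarrow> G \<in> V"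
  shows "comm_banach_algebra_on V pw_add pw_zero pw_scale (sup_norm a b) pw_mult"
proof -
  have le: "\<bar>F x\<bar> \<le> sup_norm a b F" if "F \<in> V" "x \<in> {a..b}" for F x
    using that sub R_lc_bounded by (intro abs_le_sup_norm) auto
  have outside: "F x = 0" if "F \<in> V" "x \<notin> {a..b}" for F x
    using that sub by (auto simp: R_lc_iff_bounded funs_on_def)
  have ab: "a \<le> b" "a \<in> {a..b}" using \<open>a < b\<close> by auto
  have nonneg: "0 \<le> sup_norm a b F" if "F \<in> V" for F
    using le[OF that ab(2)] by linarith
  show ?thesis
  proof
    fix u v assume u: "u \<in> V" and v: "v \<in> V"
    show "sup_norm a b (pw_add u v) \<le> sup_norm a b u + sup_norm a b v"
      by (rule sup_norm_le[OF ab(1)]) (use le[OF u] le[OF v] in \<open>fastforce simp: pw_add_def\<close>)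
    show "sup_norm a b (pw_mult u v) \<le> sup_norm a b u * sup_norm a b v"
      by (rule sup_norm_le[OF ab(1)])
        (use le[OF u] le[OF v] in \<open>auto simp: pw_mult_def abs_mult intro!: mult_mono'\<close>)
  next
    fix u c assume u: "u \<in> V"
    show "sup_norm a b (pw_scale c u) = \<bar>c\<bar> * sup_norm a b u"
    proof (rule antisym)
      show "sup_norm a b (pw_scale c u) \<le> \<bar>c\<bar> * sup_norm a b u"
        by (rule sup_norm_le[OF ab(1)])
          (use le[OF u] in \<open>auto simp: pw_scale_def abs_mult intro!: mult_left_mono\<close>)
      show "\<bar>c\<bar> * sup_norm a b u \<le> sup_norm a b (pw_scale c u)"
      proof (cases "c = 0")
        case True
        then show ?thesis using nonneg[OF scale[OF u]] by simp
      next
        case False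
        have "sup_norm a b u \<le> sup_norm a b (pw_scale c u) / \<bar>c\<bar>"
          by (rule sup_norm_le[OF ab(1)])
            (use le[OF scale[OF u], of _ c] False in \<open>auto simp: pw_scale_def abs_mult field_simps\<close>)
        then show ?thesis using False by (simp add: field_simps)
      qed
    qed
  next
    fix u assume u: "u \<in> V"
    show "sup_norm a b u = 0 \<longleftrightarrow> u = pw_zero"
    proof
      assume "sup_norm a b u = 0"
      then have "u x = 0" for x using le[OF u, of x] outside[OF u, of x] by fastforce
      then show "u = pw_zero" by (auto simp: pw_zero_def)
    next
      assume "u = pw_zero"
      then show "sup_norm a b u = 0" using ab(1) by (simp add: sup_norm_def pw_zero_def)
    qed
    show "\<exists>v\<in>V. pw_add u v = pw_zero"
      using scale[OF u, of "-1"] by (intro bexI[of _ "pw_scale (-1) u"]) (auto simp: pw_add_def pw_scale_def pw_zero_def)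
  next
    fix s :: "nat \<Rightarrow> real \<Rightarrow> real"
    assume s: "\<And>n. s n \<in> V" and Cauchy: "\<And>e. e > 0 \<Longrightarrow>
      \<exists>N. \<forall>m\<ge>N. \<forall>n\<ge>N. sup_norm a b (pw_add (s m) (pw_scale (- 1) (s n))) < e"
    define d where "d F G = sup_norm a b (pw_add F (pw_scale (- 1) G))" for F G :: "real \<Rightarrow> real"
    have dist_le: "dist (F x) (G x) \<le> d F G" if "F \<in> V" "G \<in> V" for F G x
    proof (cases "x \<in> {a..b}")
      case True
      then show ?thesis using le[OF add[OF that(1) scale[OF that(2), of "-1"]] True]
        by (simp add: d_def pw_add_def pw_scale_def dist_real_def)
    next
      case False
      then show ?thesis using outside[of F x] outside[of G x] that
          nonneg[OF add[OF that(1) scale[OF that(2), of "-1"]]] by (simp add: d_def)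
    qed
    have "uniformly_Cauchy_on UNIV s"
    proof (rule uniformly_Cauchy_onI)
      fix e :: real assume "e > 0"
      from Cauchy[OF this] obtain N where "\<And>m n. m \<ge> N \<Longrightarrow> n \<ge> N \<Longrightarrow> d (s m) (s n) < e"
        by (auto simp: d_def)
      then show "\<exists>M. \<forall>x\<in>UNIV. \<forall>m\<ge>M. \<forall>n\<ge>M. dist (s m x) (s n x) < e"
        using dist_le[OF s s] by (meson le_less_trans)
    qed
    then obtain G where G: "uniform_limit UNIV s G sequentially"
      using Cauchy_uniformly_convergent by (auto simp: uniformly_convergent_on_def)
    have "G \<in> V"
    proof (rule closed[OF s])
      show "G \<in> R_lc a b" by (rule R_lc_uniform_limit[OF _ G]) (use s sub in auto)
      show "(\<lambda>n. s n x) \<longlonglongrightarrow> G x" for x using G by (rule tendsto_uniform_limitI) simp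
    qed
    moreover have "(\<lambda>n. d (s n) G) \<longlonglongrightarrow> 0"
    proof (rule tendstoI)
      fix e :: real assume "e > 0"
      then have "eventually (\<lambda>n. \<forall>x\<in>UNIV. dist (s n x) (G x) < e / 2) sequentially"
        by (intro uniform_limitD[OF G]) simp
      then show "eventually (\<lambda>n. dist (d (s n) G) 0 < e) sequentially"
      proof eventually_elim
        case (elim n)
        have "d (s n) G \<le> e / 2" unfolding d_def
          by (rule sup_norm_le[OF ab(1)])
            (use elim in \<open>auto simp: pw_add_def pw_scale_def dist_real_def intro!: less_imp_le\<close>)
        moreover have "0 \<le> d (s n) G"
          unfolding d_def by (intro nonneg add scale s \<open>G \<in> V\<close>)
        ultimately show ?case using \<open>e > 0\<close> by (simp add: dist_real_def)
      qed
    qed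
    ultimately show "\<exists>u\<in>V. (\<lambda>n. sup_norm a b (pw_add (s n) (pw_scale (- 1) u))) \<longlonglongrightarrow> 0"
      unfolding d_def by blast
  qed (auto simp: zero add scale mult nonneg,
      auto simp: pw_add_def pw_scale_def pw_zero_def pw_mult_def algebra_simps)
qed

lemma R_lc_comm_banach_algebra:
  assumes "a < b"
  shows "comm_banach_algebra_on (R_lc a b) pw_add pw_zero pw_scale (sup_norm a b) pw_mult"
  using assms
  by (rule comm_banach_algebra_on_R_lc_closed_subalgebra)
    (auto intro: R_lc_zero R_lc_add R_lc_scale R_lc_mult)

lemma R_lc0_comm_banach_algebra:
  assumes "a < b"
  shows "comm_banach_algebra_on (R_lc0 a b) pw_add pw_zero pw_scale (sup_norm a b) pw_mult"
  using assms
proof (rule comm_banach_algebra_on_R_lc_closed_subalgebra)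
  fix s G assume s: "\<And>n. s n \<in> R_lc0 a b" and G: "G \<in> R_lc a b" "\<And>x. (\<lambda>n. s n x) \<longlonglongrightarrow> G x"
  have "G a = 0" using G(2)[of a] s by (simp add: R_lc0_def LIMSEQ_const_iff)
  with G(1) show "G \<in> R_lc0 a b" by (simp add: R_lc0_def)
qed (auto simp: R_lc0_def R_lc_zero R_lc_add R_lc_scale R_lc_mult,
    auto simp: pw_add_def pw_zero_def pw_scale_def pw_mult_def)

text \<open>Serves to carry the axioms from primitives to their distributional derivatives. Completeness
transfers because \<open>D\<close> is an isometry, so Cauchy sequences correspond.\<close>

lemma comm_banach_algebra_on_transport:
  fixes V :: "'v set" and add zero scale nrm mul and D :: "'v \<Rightarrow> 'w"
  assumes "comm_banach_algebra_on V add zero scale nrm mul" and bij: "bij_betw D V W"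
    and add: "\<And>u v. u \<in> V \<Longrightarrow> v \<in> V \<Longrightarrow> add' (D u) (D v) = D (add u v)"
    and zero: "zero' = D zero"
    and scale: "\<And>c u. u \<in> V \<Longrightarrow> scale' c (D u) = D (scale c u)"
    and nrm: "\<And>u. u \<in> V \<Longrightarrow> nrm' (D u) = nrm u"
    and mult: "\<And>u v. u \<in> V \<Longrightarrow> v \<in> V \<Longrightarrow> mult' (D u) (D v) = D (mul u v)"
  shows "comm_banach_algebra_on W add' zero' scale' nrm' mult'"
proof -
  interpret comm_banach_algebra_on V add zero scale nrm mul by fact
  have W: "W = D ` V" and inj: "inj_on D V" using bij by (auto simp: bij_betw_def)
  note ops = add zero scale nrm mult zero_closed add_closed scale_closed mult_closed
  show ?thesis
    unfolding W
  proof
    fix u' assume "u' \<in> D ` V"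
    then obtain u where u: "u \<in> V" "u' = D u" by blast
    from add_inverse[OF u(1)] obtain v where "v \<in> V" "add u v = zero" by blast
    then show "\<exists>v\<in>D ` V. add' u' v = zero'"
      by (intro bexI[of _ "D v"]) (simp_all add: ops u)
    show "nrm' u' = 0 \<longleftrightarrow> u' = zero'"
      using inj_on_eq_iff[OF inj u(1) zero_closed] by (simp add: ops u norm_eq_zero)
  next
    fix s :: "nat \<Rightarrow> 'w"
    assume "\<And>n. s n \<in> D ` V" and Cauchy: "\<And>e. e > 0 \<Longrightarrow>
        \<exists>N. \<forall>m\<ge>N. \<forall>n\<ge>N. nrm' (add' (s m) (scale' (- 1) (s n))) < e"
    then have "\<forall>n. \<exists>t\<in>V. s n = D t" by blast
    then obtain t where t: "\<And>n. t n \<in> V" and s: "s = (\<lambda>n. D (t n))" by metis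
    have "\<exists>N. \<forall>m\<ge>N. \<forall>n\<ge>N. nrm (add (t m) (scale (- 1) (t n))) < e" if "e > 0" for e
      using Cauchy[OF that] by (simp add: s ops t)
    from complete[OF t this] obtain u
      where "u \<in> V" "(\<lambda>n. nrm (add (t n) (scale (-1) u))) \<longlonglongrightarrow> 0" by blast
    then show "\<exists>u\<in>D ` V. (\<lambda>n. nrm' (add' (s n) (scale' (- 1) u))) \<longlonglongrightarrow> 0"
      by (intro bexI[of _ "D u"]) (auto simp: s ops t)
  qed (auto simp: ops add_assoc add_zero scale_one scale_scale scale_add_right scale_add_left
        norm_nonneg norm_scale norm_triangle mult_assoc mult_add scale_mult norm_mult,
      auto simp: add_comm mult_comm)
qed

section \<open>Smooth functions and smooth steps\<close>

definition smooth :: "(real \<Rightarrow> real) \<Rightarrow> bool" where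
  "smooth f \<longleftrightarrow> (\<forall>m x. (deriv ^^ m) f differentiable (at x))"

text \<open>Smooth functions are the largest class of differentiable functions closed under \<open>deriv\<close>. With this rule no formula for
higher derivatives is ever needed: it suffices to exhibit a class of functions that is closed under
differentiation.\<close>

lemma smooth_coinduct:
  assumes "f \<in> S"
    and "\<And>g. g \<in> S \<Longrightarrow> \<exists>g'\<in>S. \<forall>x. (g has_real_derivative g' x) (at x)"
  shows "smooth f"
proof -
  have "(deriv ^^ m) f \<in> S" for m
  proof (induction m)
    case 0
    show ?case using assms(1) by simp
  next
    case (Suc m)
    from assms(2)[OF Suc] obtain g' where g': "g' \<in> S"
      "\<And>x. ((deriv ^^ m) f has_real_derivative g' x) (at x)" by blast
    have "deriv ((deriv ^^ m) f) = g'" using g'(2) by (intro ext DERIV_imp_deriv)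
    with g'(1) show ?case by simp
  qed
  then show ?thesis
    using assms(2) unfolding smooth_def real_differentiable_def by blast
qed

lemma smooth_deriv:
  assumes "smooth f"
  shows "smooth (deriv f)"
  unfolding smooth_def
proof (intro allI)
  fix m x
  have "(deriv ^^ Suc m) f differentiable (at x)" using assms unfolding smooth_def by blast
  then show "(deriv ^^ m) (deriv f) differentiable (at x)" by (simp add: funpow_swap1)
qed

lemma smooth_has_derivative:
  assumes "smooth f"
  shows "(f has_real_derivative deriv f x) (at x)"
proof -
  have "(deriv ^^ 0) f differentiable (at x)" using assms unfolding smooth_def by blast
  then show ?thesis
    by (auto simp: real_differentiable_def DERIV_deriv_iff_real_differentiable)
qed

lemma smooth_if_has_smooth_derivative:
  assumes "\<And>x. (f has_real_derivative g x) (at x)" "smooth g"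
  shows "smooth f"
proof (rule smooth_coinduct[where S = "insert f (Collect smooth)"])
  show "\<exists>h'\<in>insert f (Collect smooth). \<forall>x. (h has_real_derivative h' x) (at x)"
    if "h \<in> insert f (Collect smooth)" for h
    using that assms smooth_deriv smooth_has_derivative by blast
qed simp

lemma smooth_continuous_on: "smooth f \<Longrightarrow> continuous_on A f"
  using smooth_has_derivative DERIV_isCont continuous_at_imp_continuous_on by blast

lemma smooth_add: 
  assumes "smooth f" "smooth g"
  shows "smooth (\<lambda>x. f x + g x)"
proof (rule smooth_coinduct[where S = "{\<lambda>x. f x + g x |f g. smooth f \<and> smooth g}"])
  fix h assume "h \<in> {\<lambda>x. f x + g x |f g. smooth f \<and> smooth g}"
  then obtain f g where h: "h = (\<lambda>x. f x + g x)" "smooth f" "smooth g" by blast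
  then show "\<exists>h'\<in>{\<lambda>x. f x + g x |f g. smooth f \<and> smooth g}. \<forall>x. (h has_real_derivative h' x) (at x)"
    by (intro bexI[of _ "\<lambda>x. deriv f x + deriv g x"])
      (auto intro!: DERIV_add smooth_deriv smooth_has_derivative)
qed (use assms in blast)

lemma smooth_affine_has_derivative:
  assumes "smooth f"
  shows "((\<lambda>t. f (p * t + q)) has_real_derivative p * deriv f (p * t + q)) (at t)"
proof -
  have "((\<lambda>t. p * t + q) has_real_derivative p) (at t)" by (auto intro!: derivative_eq_intros)
  from DERIV_chain2[OF smooth_has_derivative[OF assms] this] show ?thesis by (simp add: mult.commute)
qed

lemma smooth_affine:
  assumes "smooth f"
  shows "smooth (\<lambda>x. k * f (p * x + q))"
proof (rule smooth_coinduct[where S = "{\<lambda>x. k * f (p * x + q) |k f. smooth f}"])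
  fix h assume "h \<in> {\<lambda>x. k * f (p * x + q) |k f. smooth f}"
  then obtain k f where h: "h = (\<lambda>x. k * f (p * x + q))" "smooth f" by blast
  have "(h has_real_derivative (k * p) * deriv f (p * x + q)) (at x)" for x
    using DERIV_cmult[OF smooth_affine_has_derivative[OF h(2)], of k p q x]
    unfolding h(1) by (simp add: mult.assoc)
  with h(2) show "\<exists>h'\<in>{\<lambda>x. k * f (p * x + q) |k f. smooth f}. \<forall>x. (h has_real_derivative h' x) (at x)"
    by (intro bexI[of _ "\<lambda>x. (k * p) * deriv f (p * x + q)"]) (auto intro: smooth_deriv)
qed (use assms in blast)

text \<open>By the product rule, the finite sums of products of smooth functions are closed under
differentiation.\<close>

lemma smooth_mult:
  assumes "smooth f" "smooth g"
  shows "smooth (\<lambda>x. f x * g x)"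
proof -
  define S where "S = {\<lambda>x. (\<Sum>i<n. u i x * v i x) |(n::nat) u v. \<forall>i. smooth (u i) \<and> smooth (v i)}"
  have "(\<lambda>x. f x * g x) \<in> S"
    unfolding S_def
    by (rule CollectI, rule exI[of _ 1], rule exI[of _ "\<lambda>i. f"], rule exI[of _ "\<lambda>i. g"])
      (use assms in auto)
  then show ?thesis
  proof (rule smooth_coinduct)
    fix h assume "h \<in> S"
    then obtain n :: nat and u v where h: "h = (\<lambda>x. \<Sum>i<n. u i x * v i x)"
      and uv: "\<And>i. smooth (u i)" "\<And>i. smooth (v i)" by (auto simp: S_def)
    define U where "U i = (if i < n then deriv (u i) else u (i - n))" for i
    define V where "V i = (if i < n then v i else deriv (v (i - n)))" for i
    have sum: "(\<Sum>i<n + n. U i x * V i x) = (\<Sum>i<n. deriv (u i) x * v i x + u i x * deriv (v i) x)" for x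
    proof -
      have "(\<Sum>i<n + n. U i x * V i x) = (\<Sum>i<n. U i x * V i x) + (\<Sum>i<n. U (i + n) x * V (i + n) x)"
        using sum.shift_bounds_nat_ivl[of "\<lambda>i. U i x * V i x" 0 n n]
        by (simp add: lessThan_atLeast0 sum.atLeastLessThan_concat[of 0 n "n + n", symmetric])
      then show ?thesis by (simp add: U_def V_def sum.distrib)
    qed
    have "(h has_real_derivative (\<Sum>i<n + n. U i x * V i x)) (at x)" for x
      unfolding sum h
      by (auto intro!: derivative_eq_intros smooth_has_derivative uv simp: mult.commute)
    moreover have "(\<lambda>x. \<Sum>i<n + n. U i x * V i x) \<in> S"
      unfolding S_def
      by (rule CollectI, rule exI[of _ "n + n"], rule exI[of _ U], rule exI[of _ V])
        (use uv in \<open>auto simp: U_def V_def intro: smooth_deriv\<close>)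
    ultimately show "\<exists>h'\<in>S. \<forall>x. (h has_real_derivative h' x) (at x)"
      by (intro bexI[of _ "\<lambda>x. \<Sum>i<n + n. U i x * V i x"] allI)
  qed
qed

text \<open>The functions that agree with \<open>p(1/x) exp(-1/x)\<close> on the positive half line and vanish elsewhere, for
polynomials \<open>p\<close>. The polynomial parameter makes the family closed under differentiation.\<close>

definition flat_exp :: "real poly \<Rightarrow> real \<Rightarrow> real" where
  "flat_exp p x = (if x > 0 then poly p (1 / x) * exp (- (1 / x)) else 0)"

lemma tendsto_poly_times_exp_minus: "((\<lambda>y. poly p y * exp (- y)) \<longlongrightarrow> (0::real)) at_top"
proof -
  have "poly p y * exp (- y) = (\<Sum>i\<le>degree p. coeff p i * (y ^ i / exp y))" for y
    by (simp add: poly_altdef sum_distrib_right exp_minus divide_inverse mult.assoc)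
  moreover have "((\<lambda>y. \<Sum>i\<le>degree p. coeff p i * (y ^ i / exp y)) \<longlongrightarrow> (\<Sum>i\<le>degree p. coeff p i * 0)) at_top"
    by (intro tendsto_sum tendsto_mult tendsto_const tendsto_power_div_exp_0)
  ultimately show ?thesis by simp
qed

text \<open>For positive \<open>x\<close> the chain rule replaces \<open>p(y)\<close> by \<open>(p(y) - p'(y)) y^2\<close>, where \<open>y = 1/x\<close>. At \<open>0\<close> both
one-sided difference quotients tend to \<open>0\<close>, the right one because the exponential beats every
polynomial.\<close>

lemma flat_exp_has_derivative:
  "(flat_exp p has_real_derivative flat_exp ((p - pderiv p) * [:0, 0, 1:]) x) (at x)"
proof -
  consider "x < 0" | "x = 0" | "x > 0" by linarith
  then show ?thesis
  proof cases
    case 1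
    have "((\<lambda>x. 0) has_real_derivative 0) (at x)" by simp
    then have "(flat_exp p has_real_derivative 0) (at x)"
      by (rule has_field_derivative_transform_within_open[where S = "{..<0}"])
        (use 1 in \<open>auto simp: flat_exp_def\<close>)
    then show ?thesis using 1 by (simp add: flat_exp_def)
  next
    case 2
    have "((\<lambda>h. poly (p * [:0, 1:]) (1 / h) * exp (- (1 / h))) \<longlongrightarrow> 0) (at_right 0)"
      using filterlim_compose[OF tendsto_poly_times_exp_minus filterlim_inverse_at_top_right]
      unfolding inverse_eq_divide .
    then have "((\<lambda>h. (flat_exp p (0 + h) - flat_exp p 0) / h) \<longlongrightarrow> 0) (at_right 0)"
      by (rule Lim_transform_eventually)
        (auto simp: flat_exp_def eventually_at_right_field field_simps intro: exI[of _ 1])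
    moreover have "((\<lambda>h. (flat_exp p (0 + h) - flat_exp p 0) / h) \<longlongrightarrow> 0) (at_left 0)"
      by (rule Lim_transform_eventually[OF tendsto_const])
        (auto simp: flat_exp_def eventually_at_left_field field_simps intro: exI[of _ "-1"])
    ultimately have "((\<lambda>h. (flat_exp p (0 + h) - flat_exp p 0) / h) \<longlongrightarrow> 0) (at 0)"
      by (simp add: filterlim_at_split)
    then show ?thesis using 2 by (simp add: DERIV_def flat_exp_def)
  next
    case 3
    have "((\<lambda>x. poly p (1 / x) * exp (- (1 / x))) has_real_derivative
        flat_exp ((p - pderiv p) * [:0, 0, 1:]) x) (at x)"
      using 3
      by (auto intro!: derivative_eq_intros DERIV_chain2[where f = "poly p"]
           simp: flat_exp_def field_simps power2_eq_square)
    then show ?thesis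
      by (rule has_field_derivative_transform_within_open[where S = "{0<..}"])
        (use 3 in \<open>auto simp: flat_exp_def\<close>)
  qed
qed

lemma smooth_flat_exp: "smooth (flat_exp p)"
  by (rule smooth_coinduct[where S = "range flat_exp"]) (use flat_exp_has_derivative in blast)+

lemma smooth_bump_exists:
  obtains B :: "real \<Rightarrow> real" where "smooth B" "\<And>x. 0 \<le> B x" "\<And>x. B x \<noteq> 0 \<longleftrightarrow> 0 < x \<and> x < 1"
proof
  define B where "B x = flat_exp 1 x * flat_exp 1 (1 - x)" for x
  have "smooth (\<lambda>x. flat_exp 1 (1 - x))"
    using smooth_affine[OF smooth_flat_exp, of 1 1 "-1" 1] by simp
  then show "smooth B"
    unfolding B_def using smooth_flat_exp by (rule smooth_mult[rotated])
  show "0 \<le> B x" "B x \<noteq> 0 \<longleftrightarrow> 0 < x \<and> x < 1" for x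
    by (auto simp: B_def flat_exp_def)
qed

text \<open>The step is the normalised antiderivative of the bump. Its derivative is the averaging kernel used
to test left continuity, and differences of rescaled steps are test functions.\<close>

lemma smooth_step_exists:
  obtains S :: "real \<Rightarrow> real" where "smooth S"
    "\<And>x. 0 \<le> deriv S x" "\<And>x. deriv S x \<noteq> 0 \<Longrightarrow> 0 < x \<and> x < 1"
    "\<And>x. x \<le> 0 \<Longrightarrow> S x = 0" "\<And>x. x \<ge> 1 \<Longrightarrow> S x = 1"
proof -
  obtain B :: "real \<Rightarrow> real" where B: "smooth B" "\<And>x. 0 \<le> B x" "\<And>x. B x \<noteq> 0 \<longleftrightarrow> 0 < x \<and> x < 1"
    using smooth_bump_exists by blast
  \<comment> \<open>Starting at \<open>-1\<close> instead of \<open>0\<close> makes \<open>0\<close> an interior point of the range of integration.\<close>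
  define S where "S x = integral {-1..x} B" for x
  have B0: "B x = 0" if "\<not> (0 < x \<and> x < 1)" for x using B(3) that by blast
  have cont: "continuous_on A B" for A using B(1) by (rule smooth_continuous_on)
  have S0: "S x = 0" if "x \<le> 0" for x
  proof -
    have "S x = integral {-1..x} (\<lambda>x. 0)"
      unfolding S_def by (intro integral_cong B0) (use that in auto)
    then show ?thesis by simp
  qed
  have deriv: "(S has_real_derivative B x) (at x)" for x
  proof (cases "x < 0")
    case True
    have "((\<lambda>x. 0) has_real_derivative 0) (at x)" by simp
    then have "(S has_real_derivative 0) (at x)"
      by (rule has_field_derivative_transform_within_open[where S = "{..<0}"])
        (use True S0 in auto)
    then show ?thesis using True B(3)[of x] by simp
  next
    case False
    then have x: "x \<in> {-1<..<x + 1}" by simp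
    have "(S has_real_derivative B x) (at x within {-1..x + 1})"
      unfolding S_def using x by (intro integral_has_real_derivative cont) auto
    then have "(S has_real_derivative B x) (at x within {-1<..<x + 1})"
      by (rule DERIV_subset) auto
    then show ?thesis unfolding at_within_open[OF x open_greaterThanLessThan] .
  qed
  have S1: "S x = S 1" if "x \<ge> 1" for x
  proof -
    have "S x = integral {-1..1} B + integral {1..x} B"
      unfolding S_def
      by (intro Henstock_Kurzweil_Integration.integral_combine[symmetric] integrable_continuous_real cont) (use that in auto)
    also have "integral {1..x} B = integral {1..x} (\<lambda>x. 0)"
      by (intro integral_cong B0) auto
    finally show ?thesis by (simp add: S_def)
  qed
  have "S 1 > S 0"
  proof (rule DERIV_pos_imp_increasing_open[of 0 1 S])
    show "\<exists>y. (S has_real_derivative y) (at x) \<and> 0 < y" if "0 < x" "x < 1" for x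
      using deriv[of x] B(2)[of x] B(3)[of x] that by (intro exI[of _ "B x"]) auto
    show "continuous_on {0..1} S"
      by (intro continuous_at_imp_continuous_on ballI DERIV_isCont[OF deriv])
  qed auto
  then have pos: "S 1 > 0" by (simp add: S0)
  have deriv1: "deriv (\<lambda>x. S x / S 1) x = B x / S 1" for x
    using deriv[of x] by (intro DERIV_imp_deriv DERIV_cdivide)
  show ?thesis
  proof (rule that[of "\<lambda>x. S x / S 1"])
    have "smooth S" by (rule smooth_if_has_smooth_derivative[OF deriv B(1)])
    then show "smooth (\<lambda>x. S x / S 1)"
      using smooth_affine[of S "1 / S 1" 1 0] by simp
    show "S x / S 1 = 1" if "x \<ge> 1" for x using S1[OF that] pos by simp
    show "0 < x \<and> x < 1" if "deriv (\<lambda>x. S x / S 1) x \<noteq> 0" for x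
      using that B(3)[of x] by (auto simp: deriv1)
  qed (use B(2) pos S0 in \<open>auto simp: deriv1\<close>)
qed

section \<open>Distributional derivatives of left regulated functions\<close>

lemma test_funs_iff_smooth: "\<phi> \<in> test_funs a b \<longleftrightarrow> smooth \<phi> \<and> closure {x. \<phi> x \<noteq> 0} \<subseteq> {a..b}"
  by (auto simp: test_funs_def smooth_def)

lemma test_funI:
  assumes "smooth \<phi>" "\<And>x. x \<notin> {a..b} \<Longrightarrow> \<phi> x = 0"
  shows "\<phi> \<in> test_funs a b"
proof -
  have "closure {x. \<phi> x \<noteq> 0} \<subseteq> {a..b}"
    by (intro closure_minimal subsetI, use assms(2) in blast) simp
  with assms(1) show ?thesis by (simp add: test_funs_iff_smooth)
qed

text \<open>The endpoints are included: the set where \<open>\<phi>\<close> is nonzero is open, hence contained in the interior of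
\<open>[a, b]\<close>. This is why constants have distributional derivative \<open>0\<close>.\<close>

lemma test_fun_outside:
  assumes "\<phi> \<in> test_funs a b" "x \<notin> {a<..<b}"
  shows "\<phi> x = 0"
proof -
  have \<phi>: "smooth \<phi>" "closure {x. \<phi> x \<noteq> 0} \<subseteq> {a..b}"
    using assms(1) by (simp_all add: test_funs_iff_smooth)
  have "continuous_on UNIV \<phi>" using \<phi>(1) by (rule smooth_continuous_on)
  then have "open {x. \<phi> x \<noteq> 0}" by (intro open_Collect_neq continuous_intros)
  with subset_trans[OF closure_subset \<phi>(2)] have "{x. \<phi> x \<noteq> 0} \<subseteq> interior {a..b}" by (rule interior_maximal)
  then have "{x. \<phi> x \<noteq> 0} \<subseteq> {a<..<b}" by simp
  with assms(2) show ?thesis by blast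
qed

lemma test_fun_smooth: "\<phi> \<in> test_funs a b \<Longrightarrow> smooth \<phi>"
  by (simp add: test_funs_iff_smooth)

lemma test_fun_deriv:
  assumes "\<phi> \<in> test_funs a b"
  shows "deriv \<phi> \<in> test_funs a b"
proof (rule test_funI)
  show "smooth (deriv \<phi>)" using assms by (intro smooth_deriv test_fun_smooth)
  fix x assume "x \<notin> {a..b}"
  then have x: "x \<in> - {a..b}" by simp
  have "(\<phi> has_real_derivative 0) (at x)"
  proof (rule has_field_derivative_transform_within_open)
    show "((\<lambda>x. 0) has_real_derivative 0) (at x)" by simp
    show "open (- {a..b})" by (rule open_Compl) simp
    show "x \<in> - {a..b}" by (rule x)
    show "0 = \<phi> y" if "y \<in> - {a..b}" for y
      using test_fun_outside[OF assms, of y] that by auto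
  qed
  then show "deriv \<phi> x = 0" by (rule DERIV_imp_deriv)
qed

lemma test_fun_add:
  assumes "\<phi> \<in> test_funs a b" "\<psi> \<in> test_funs a b"
  shows "(\<lambda>x. \<phi> x + \<psi> x) \<in> test_funs a b"
proof (rule test_funI)
  show "smooth (\<lambda>x. \<phi> x + \<psi> x)" by (intro smooth_add test_fun_smooth[OF assms(1)] test_fun_smooth[OF assms(2)])
  fix x assume "x \<notin> {a..b}"
  then have x: "x \<notin> {a<..<b}" by auto
  show "\<phi> x + \<psi> x = 0"
    unfolding test_fun_outside[OF assms(1) x] test_fun_outside[OF assms(2) x] by (rule add_0)
qed

lemma test_fun_scale:
  assumes "\<phi> \<in> test_funs a b"
  shows "(\<lambda>x. c * \<phi> x) \<in> test_funs a b"
proof (rule test_funI)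
  show "smooth (\<lambda>x. c * \<phi> x)"
    using smooth_affine[OF test_fun_smooth[OF assms], of c 1 0] by simp
  fix x assume "x \<notin> {a..b}"
  then have x: "x \<notin> {a<..<b}" by auto
  show "c * \<phi> x = 0" unfolding test_fun_outside[OF assms x] by (rule mult_zero_right)
qed

text \<open>The product is again left regulated and bounded, so it is Riemann integrable by the equivalence
above.\<close>

lemma left_regulated_mult_continuous_integrable:
  fixes F \<psi> :: "real \<Rightarrow> real"
  assumes F: "left_regulated a b F" "bounded (F ` {a..b})" and \<psi>: "continuous_on UNIV \<psi>"
  shows "(\<lambda>t. F t * \<psi> t) integrable_on {a..b}"
proof -
  have "left_regulated a b (\<lambda>t. F t * \<psi> t)"
    unfolding left_regulated_def
  proof
    fix t assume "t \<in> {a<..b}"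
    then obtain l where l: "(F \<longlongrightarrow> l) (at_left t)" using F(1) unfolding left_regulated_def by blast
    have "isCont \<psi> t" using \<psi> by (simp add: continuous_on_eq_continuous_at)
    then have "(\<psi> \<longlongrightarrow> \<psi> t) (at_left t)"
      using filterlim_at_split[of \<psi> "nhds (\<psi> t)" t] by (simp add: isCont_def)
    from tendsto_mult[OF l this] show "\<exists>l. ((\<lambda>t. F t * \<psi> t) \<longlongrightarrow> l) (at_left t)" by blast
  qed
  moreover have "bounded ((\<lambda>t. F t * \<psi> t) ` {a..b})"
  proof -
    have "compact (\<psi> ` {a..b})"
      using \<psi> by (intro compact_continuous_image) (auto intro: continuous_on_subset)
    then obtain B C where "\<forall>x\<in>{a..b}. \<bar>F x\<bar> \<le> B" "\<forall>x\<in>{a..b}. \<bar>\<psi> x\<bar> \<le> C"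
      using F(2) compact_imp_bounded[of "\<psi> ` {a..b}"] unfolding bounded_image_real_iff by blast
    then have "\<bar>F x * \<psi> x\<bar> \<le> B * C" if "x \<in> {a..b}" for x
      unfolding abs_mult using that by (intro mult_mono') auto
    then show ?thesis unfolding bounded_image_real_iff by blast
  qed
  ultimately show ?thesis
    by (intro integrable_on_if_riemann_integrable) (simp add: riemann_integrable_iff_bounded_if_left_regulated)
qed

definition dist_deriv_fun :: "real \<Rightarrow> real \<Rightarrow> (real \<Rightarrow> real) \<Rightarrow> (real \<Rightarrow> real) \<Rightarrow> real" where
  "dist_deriv_fun a b F = dist_deriv a b (dist_of_fun a b F)"

lemma dist_deriv_fun_test:
  "\<phi> \<in> test_funs a b \<Longrightarrow> dist_deriv_fun a b F \<phi> = - integral {a..b} (\<lambda>t. F t * deriv \<phi> t)"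
  by (simp add: dist_deriv_fun_def dist_deriv_def dist_of_fun_def test_fun_deriv)

lemma dist_deriv_fun_not_test: "\<phi> \<notin> test_funs a b \<Longrightarrow> dist_deriv_fun a b F \<phi> = 0"
  by (simp add: dist_deriv_fun_def dist_deriv_def)

lemma R_lc_subset_R_lr: "R_lc a b \<subseteq> R_lr a b"
  by (auto simp: R_lc_def)

lemma R_lr_mult_deriv_integrable:
  assumes "F \<in> R_lr a b" "\<phi> \<in> test_funs a b"
  shows "(\<lambda>t. F t * deriv \<phi> t) integrable_on {a..b}"
proof (rule left_regulated_mult_continuous_integrable)
  show "left_regulated a b F" using assms(1) by (simp add: R_lr_def)
  show "bounded (F ` {a..b})" by (rule R_lr_bounded[OF assms(1)])
  show "continuous_on UNIV (deriv \<phi>)"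
    by (intro smooth_continuous_on smooth_deriv test_fun_smooth[OF assms(2)])
qed

lemma dist_deriv_fun_add:
  assumes "F \<in> R_lr a b" "G \<in> R_lr a b"
  shows "dist_deriv_fun a b (pw_add F G) = pw_add (dist_deriv_fun a b F) (dist_deriv_fun a b G)"
proof
  fix \<phi>
  show "dist_deriv_fun a b (pw_add F G) \<phi> = pw_add (dist_deriv_fun a b F) (dist_deriv_fun a b G) \<phi>"
    using assms
    by (cases "\<phi> \<in> test_funs a b")
      (simp_all add: dist_deriv_fun_test dist_deriv_fun_not_test pw_add_def distrib_right
        integral_add R_lr_mult_deriv_integrable)
qed

lemma dist_deriv_fun_scale:
  "dist_deriv_fun a b (pw_scale c F) = pw_scale c (dist_deriv_fun a b F)"
proof
  fix \<phi>
  show "dist_deriv_fun a b (pw_scale c F) \<phi> = pw_scale c (dist_deriv_fun a b F) \<phi>"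
    by (cases "\<phi> \<in> test_funs a b")
      (simp_all add: dist_deriv_fun_test dist_deriv_fun_not_test pw_scale_def mult.assoc)
qed

text \<open>Sequential continuity follows from uniform convergence of the first derivatives by dominated
convergence.\<close>

lemma dist_deriv_fun_in_distributions:
  assumes F: "F \<in> R_lr a b"
  shows "dist_deriv_fun a b F \<in> distributions a b"
  unfolding distributions_def
proof (intro CollectI conjI allI ballI impI)
  fix \<phi> :: "real \<Rightarrow> real"
  show "dist_deriv_fun a b F \<phi> = 0" if "\<phi> \<notin> test_funs a b"
    using that by (rule dist_deriv_fun_not_test)
next
  fix \<phi> \<psi> :: "real \<Rightarrow> real" assume t: "\<phi> \<in> test_funs a b" "\<psi> \<in> test_funs a b"
  have "deriv (\<lambda>x. \<phi> x + \<psi> x) = (\<lambda>x. deriv \<phi> x + deriv \<psi> x)"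
    by (intro ext DERIV_imp_deriv DERIV_add smooth_has_derivative test_fun_smooth[OF t(1)] test_fun_smooth[OF t(2)])
  then show "dist_deriv_fun a b F (\<lambda>x. \<phi> x + \<psi> x) = dist_deriv_fun a b F \<phi> + dist_deriv_fun a b F \<psi>"
    using R_lr_mult_deriv_integrable[OF F] t
    by (simp add: dist_deriv_fun_test test_fun_add distrib_left integral_add)
next
  fix c and \<phi> :: "real \<Rightarrow> real" assume t: "\<phi> \<in> test_funs a b"
  have "deriv (\<lambda>x. c * \<phi> x) = (\<lambda>x. c * deriv \<phi> x)"
    by (intro ext DERIV_imp_deriv DERIV_cmult smooth_has_derivative test_fun_smooth[OF t(1)])
  then show "dist_deriv_fun a b F (\<lambda>x. c * \<phi> x) = c * dist_deriv_fun a b F \<phi>"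
    using t by (simp add: dist_deriv_fun_test test_fun_scale mult.left_commute[of _ c])
next
  fix \<phi> :: "nat \<Rightarrow> real \<Rightarrow> real" and \<psi>
  assume "(\<forall>n. \<phi> n \<in> test_funs a b) \<and> \<psi> \<in> test_funs a b \<and> test_converges \<phi> \<psi>"
  then have t: "\<And>n. \<phi> n \<in> test_funs a b" "\<psi> \<in> test_funs a b" and "test_converges \<phi> \<psi>" by auto
  then have "uniform_limit UNIV (\<lambda>n. (deriv ^^ 1) (\<phi> n)) ((deriv ^^ 1) \<psi>) sequentially"
    unfolding test_converges_def by blast
  then have unif: "uniform_limit UNIV (\<lambda>n. deriv (\<phi> n)) (deriv \<psi>) sequentially" by simp
  obtain B where B: "\<And>x. x \<in> {a..b} \<Longrightarrow> \<bar>F x\<bar> \<le> B"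
    using R_lr_bounded[OF F] unfolding bounded_image_real_iff by blast
  obtain N where N: "\<And>n x. n \<ge> N \<Longrightarrow> dist (deriv (\<phi> n) x) (deriv \<psi> x) < 1"
    using uniform_limitD[OF unif zero_less_one] by (auto simp: eventually_sequentially)
  \<comment> \<open>The shift by \<open>N\<close> gives all derivatives in the sequence a common bound.\<close>
  have "(\<lambda>n. integral {a..b} (\<lambda>t. F t * deriv (\<phi> (n + N)) t)) \<longlonglongrightarrow> integral {a..b} (\<lambda>t. F t * deriv \<psi> t)"
  proof (rule dominated_convergence(2)[where h = "\<lambda>t. B * (\<bar>deriv \<psi> t\<bar> + 1)"])
    show "(\<lambda>t. F t * deriv (\<phi> (n + N)) t) integrable_on {a..b}" for n
      by (rule R_lr_mult_deriv_integrable[OF F t(1)])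
    have "smooth (deriv \<psi>)" by (intro smooth_deriv test_fun_smooth[OF t(2)])
    then show "(\<lambda>t. B * (\<bar>deriv \<psi> t\<bar> + 1)) integrable_on {a..b}"
      by (intro integrable_continuous_real continuous_intros smooth_continuous_on)
    show "norm (F x * deriv (\<phi> (n + N)) x) \<le> B * (\<bar>deriv \<psi> x\<bar> + 1)" if "x \<in> {a..b}" for n x
    proof -
      have "\<bar>deriv (\<phi> (n + N)) x\<bar> \<le> \<bar>deriv \<psi> x\<bar> + 1"
        using N[of "n + N" x] by (simp add: dist_real_def)
      then show ?thesis
        using B[OF that] unfolding real_norm_def abs_mult by (intro mult_mono') auto
    qed
    show "(\<lambda>n. F x * deriv (\<phi> (n + N)) x) \<longlonglongrightarrow> F x * deriv \<psi> x" for x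
      using tendsto_uniform_limitI[OF unif, of x]
      by (intro tendsto_mult_left LIMSEQ_ignore_initial_segment) simp
  qed
  then have "(\<lambda>n. integral {a..b} (\<lambda>t. F t * deriv (\<phi> n) t)) \<longlonglongrightarrow> integral {a..b} (\<lambda>t. F t * deriv \<psi> t)"
    by (rule LIMSEQ_offset)
  then show "(\<lambda>n. dist_deriv_fun a b F (\<phi> n)) \<longlonglongrightarrow> dist_deriv_fun a b F \<psi>"
    using t by (simp add: dist_deriv_fun_test tendsto_minus)
qed

section \<open>Existence and uniqueness of primitives\<close>

lemma left_limit_bound:
  fixes H :: "real \<Rightarrow> real"
  assumes "a \<le> s" "t \<le> b" "y \<in> {s<..t}"
    and H: "\<And>x. x \<in> {s<..<t} \<Longrightarrow> \<bar>H x - l\<bar> \<le> e"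
    and G: "(H \<longlongrightarrow> G) (at_left y)"
  shows "\<bar>G - l\<bar> \<le> e"
proof (rule tendsto_upperbound)
  show "((\<lambda>x. \<bar>H x - l\<bar>) \<longlongrightarrow> \<bar>G - l\<bar>) (at_left y)" using G by (intro tendsto_intros)
  have "x \<in> {s<..<t}" if "x \<in> {s<..<y}" for x using that assms(3) by auto
  then show "eventually (\<lambda>x. \<bar>H x - l\<bar> \<le> e) (at_left y)"
    unfolding eventually_at_left_field using H assms(3) by (intro exI[of _ s]) auto
qed simp

text \<open>Replace every value \<open>H(t)\<close> by the left limit at \<open>t\<close>, and \<open>H(a)\<close> by the right limit at \<open>a\<close>. The result \<open>G\<close>
has the same left limits and the same right limit at \<open>a\<close> as \<open>H\<close>, because a closed bound for \<open>H\<close> on an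
interval passes to its left limits there. Apart from the endpoints, values change only at the
countably many discontinuities of \<open>H\<close>, which integrals do not see.\<close>

lemma left_continuous_modification:
  assumes H: "H \<in> R_lr a b" and "a < b"
  obtains G where "G \<in> R_lc a b" "dist_deriv_fun a b G = dist_deriv_fun a b H"
proof -
  have "\<forall>t. \<exists>l. t \<in> {a<..b} \<longrightarrow> (H \<longlongrightarrow> l) (at_left t)"
    using H by (simp add: R_lr_def left_regulated_def)
  then obtain L where L: "\<And>t. t \<in> {a<..b} \<Longrightarrow> (H \<longlongrightarrow> L t) (at_left t)"
    unfolding choice_iff by blast
  obtain r where r: "(H \<longlongrightarrow> r) (at_right a)"
    using H by (auto simp: R_lr_def)
  define G where "G t = (if t \<in> {a<..b} then L t else if t = a then r else 0)" for t
  obtain B where B: "\<And>x. x \<in> {a..b} \<Longrightarrow> \<bar>H x\<bar> \<le> B"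
    using R_lr_bounded[OF H] unfolding bounded_image_real_iff by blast
  have close: "\<bar>G y - l\<bar> \<le> e"
    if "a \<le> s" "t \<le> b" "y \<in> {s<..t}" "\<And>x. x \<in> {s<..<t} \<Longrightarrow> \<bar>H x - l\<bar> \<le> e" for s t y l e
  proof -
    have y: "y \<in> {a<..b}" using that(1-3) by auto
    then have "(H \<longlongrightarrow> G y) (at_left y)" using L by (simp add: G_def)
    with that show ?thesis by (rule left_limit_bound)
  qed
  have "G \<in> R_lc a b"
    unfolding R_lc_iff_bounded
  proof (intro conjI ballI)
    show "G \<in> funs_on a b" using \<open>a < b\<close> by (auto simp: funs_on_def G_def)
    have "\<bar>G x\<bar> \<le> max B \<bar>r\<bar>" if "x \<in> {a..b}" for x
    proof (cases "x = a")
      case True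
      then show ?thesis by (simp add: G_def)
    next
      case False
      with that have "\<bar>G x - 0\<bar> \<le> B" by (intro close[of a b]) (auto intro: B)
      then show ?thesis by simp
    qed
    then show "bounded (G ` {a..b})" unfolding bounded_image_real_iff by blast
  next
    fix t assume t: "t \<in> {a<..b}"
    show "(G \<longlongrightarrow> G t) (at_left t)"
    proof (rule tendstoI)
      fix e :: real assume "e > 0"
      then have "eventually (\<lambda>x. dist (H x) (L t) < e / 2) (at_left t)"
        using L[OF t] by (intro tendstoD) auto
      then obtain s where s: "s < t" "\<And>x. s < x \<Longrightarrow> x < t \<Longrightarrow> dist (H x) (L t) < e / 2"
        unfolding eventually_at_left_field by blast
      have "\<bar>G y - L t\<bar> \<le> e / 2" if "max s a < y" "y < t" for y
        using that t s(2) by (intro close[of "max s a" t]) (auto simp: dist_real_def intro: less_imp_le)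
      moreover have "G t = L t" using t by (simp add: G_def)
      ultimately show "eventually (\<lambda>x. dist (G x) (G t) < e) (at_left t)"
        unfolding eventually_at_left_field using s(1) t \<open>e > 0\<close>
        by (intro exI[of _ "max s a"]) (fastforce simp: dist_real_def)
    qed
  next
    show "(G \<longlongrightarrow> G a) (at_right a)"
    proof (rule tendstoI)
      fix e :: real assume "e > 0"
      then have "eventually (\<lambda>x. dist (H x) r < e / 2) (at_right a)"
        using r by (intro tendstoD) auto
      then obtain s where s: "s > a" "\<And>x. a < x \<Longrightarrow> x < s \<Longrightarrow> dist (H x) r < e / 2"
        unfolding eventually_at_right_field by blast
      have "\<bar>G y - r\<bar> \<le> e / 2" if "a < y" "y < min s b" for y
        using that s(2) by (intro close[of a "min s b"]) (auto simp: dist_real_def intro: less_imp_le)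
      moreover have "G a = r" by (simp add: G_def)
      ultimately show "eventually (\<lambda>x. dist (G x) (G a) < e) (at_right a)"
        unfolding eventually_at_right_field using s(1) \<open>a < b\<close> \<open>e > 0\<close>
        by (intro exI[of _ "min s b"]) (fastforce simp: dist_real_def)
    qed
  qed
  moreover have "dist_deriv_fun a b G = dist_deriv_fun a b H"
  proof
    fix \<phi>
    define N where "N = {x \<in> {a<..<b}. \<not> isCont H x} \<union> {a, b}"
    have "countable {x \<in> {a<..<b}. \<not> isCont H x}"
      by (rule countable_discontinuities_if_left_limits) (use H in \<open>simp add: R_lr_def\<close>)
    then have N: "negligible N" unfolding N_def by (intro negligible_if_countable) simp
    have "G x = H x" if "x \<in> {a..b} - N" for x
    proof -
      from that have x: "x \<in> {a<..b}" "isCont H x" by (auto simp: N_def less_le)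
      then have "(H \<longlongrightarrow> H x) (at_left x)"
        using filterlim_at_split[of H "nhds (H x)" x] by (simp add: isCont_def)
      with L[OF x(1)] have "L x = H x" by (rule tendsto_unique[rotated]) simp
      with x(1) show ?thesis by (simp add: G_def)
    qed
    then have "integral {a..b} (\<lambda>t. G t * deriv \<phi> t) = integral {a..b} (\<lambda>t. H t * deriv \<phi> t)"
      by (intro integral_spike[OF N]) simp
    then show "dist_deriv_fun a b G \<phi> = dist_deriv_fun a b H \<phi>"
      by (cases "\<phi> \<in> test_funs a b") (simp_all add: dist_deriv_fun_test dist_deriv_fun_not_test)
  qed
  ultimately show ?thesis by (rule that)
qed

definition one_on :: "real \<Rightarrow> real \<Rightarrow> real \<Rightarrow> real" where
  "one_on a b t = (if t \<in> {a..b} then 1 else 0)"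

lemma one_on_R_lc:
  assumes "a < b"
  shows "one_on a b \<in> R_lc a b"
  unfolding R_lc_iff_bounded
proof (intro conjI ballI)
  show "one_on a b \<in> funs_on a b" by (auto simp: funs_on_def one_on_def)
  show "bounded (one_on a b ` {a..b})"
    unfolding bounded_image_real_iff by (intro exI[of _ 1]) (simp add: one_on_def)
  show "(one_on a b \<longlongrightarrow> one_on a b t) (at_left t)" if t: "t \<in> {a<..b}" for t
    by (rule tendsto_eventually)
      (use t in \<open>auto simp: eventually_at_left_field one_on_def intro!: exI[of _ a]\<close>)
  show "(one_on a b \<longlongrightarrow> one_on a b a) (at_right a)"
    by (rule tendsto_eventually)
      (use assms in \<open>auto simp: eventually_at_right_field one_on_def intro!: exI[of _ b]\<close>)
qed

lemma dist_deriv_fun_one_on: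
  assumes "a < b"
  shows "dist_deriv_fun a b (one_on a b) = pw_zero"
proof
  fix \<phi> :: "real \<Rightarrow> real"
  show "dist_deriv_fun a b (one_on a b) \<phi> = pw_zero \<phi>"
  proof (cases "\<phi> \<in> test_funs a b")
    case True
    have "(deriv \<phi> has_integral \<phi> b - \<phi> a) {a..b}"
      using assms smooth_has_derivative[OF test_fun_smooth[OF True]]
      by (intro fundamental_theorem_of_calculus)
        (auto simp flip: has_real_derivative_iff_has_vector_derivative intro: has_field_derivative_at_within)
    then have "integral {a..b} (deriv \<phi>) = 0"
      using test_fun_outside[OF True, of a] test_fun_outside[OF True, of b] by (simp add: integral_unique)
    moreover have "integral {a..b} (\<lambda>t. one_on a b t * deriv \<phi> t) = integral {a..b} (deriv \<phi>)"
      by (rule integral_cong) (simp add: one_on_def)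
    ultimately show ?thesis using True by (simp add: dist_deriv_fun_test pw_zero_def)
  qed (simp add: dist_deriv_fun_not_test pw_zero_def)
qed

text \<open>Subtracting the constant \<open>G(a)\<close> from the left-continuous modification \<open>G\<close> normalises it at \<open>a\<close> without
changing its derivative.\<close>

lemma primitive_exists:
  assumes "a < b" "H \<in> R_lr a b"
  obtains F where "F \<in> R_lc0 a b" "dist_deriv_fun a b F = dist_deriv_fun a b H"
proof -
  obtain G where G: "G \<in> R_lc a b" "dist_deriv_fun a b G = dist_deriv_fun a b H"
    using left_continuous_modification[OF assms(2,1)] by blast
  define F where "F = pw_add G (pw_scale (- G a) (one_on a b))"
  have c: "pw_scale (- G a) (one_on a b) \<in> R_lc a b"
    by (intro R_lc_scale one_on_R_lc assms(1))
  have "F \<in> R_lc a b" unfolding F_def by (intro R_lc_add G(1) c)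
  moreover have "F a = 0"
    using assms(1) by (simp add: F_def pw_add_def pw_scale_def one_on_def)
  ultimately have "F \<in> R_lc0 a b" by (simp add: R_lc0_def)
  moreover have "dist_deriv_fun a b F = dist_deriv_fun a b H"
    unfolding F_def dist_deriv_fun_add[OF subsetD[OF R_lc_subset_R_lr G(1)] subsetD[OF R_lc_subset_R_lr c]]
      dist_deriv_fun_scale dist_deriv_fun_one_on[OF assms(1)] G(2)
    by (simp add: pw_add_def pw_scale_def pw_zero_def)
  ultimately show ?thesis by (rule that)
qed

text \<open>The kernel \<open>K\<close> is a probability density concentrated on \<open>(s, c)\<close>, so integrating \<open>F\<close> against it gives a
weighted average of the values of \<open>F\<close> immediately to the left of \<open>c\<close>. The argument of \<open>deriv S\<close> is
\<open>(t - s) / (c - s)\<close>, written as an affine function of \<open>t\<close>.\<close>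

lemma left_average_close:
  assumes F: "left_regulated a b F" "bounded (F ` {a..b})"
    and S: "smooth S" "\<And>x. 0 \<le> deriv S x" "\<And>x. deriv S x \<noteq> 0 \<Longrightarrow> 0 < x \<and> x < 1"
      "\<And>x. x \<le> 0 \<Longrightarrow> S x = 0" "\<And>x. x \<ge> 1 \<Longrightarrow> S x = 1"
    and c: "a \<le> s" "s < c" "c \<le> b" and close: "\<And>t. s < t \<Longrightarrow> t < c \<Longrightarrow> \<bar>F t - F c\<bar> \<le> e"
  defines "K \<equiv> \<lambda>t. 1 / (c - s) * deriv S (1 / (c - s) * t + - s / (c - s))"
  shows "\<bar>integral {a..b} (\<lambda>t. F t * K t) - F c\<bar> \<le> e"
proof -
  define u where "u t = 1 / (c - s) * t + - s / (c - s)" for t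
  have u: "u t = (t - s) / (c - s)" for t by (simp add: u_def diff_divide_distrib)
  have K: "K t = 1 / (c - s) * deriv S (u t)" for t by (simp add: K_def u_def)
  have "smooth K"
    unfolding K_def using S(1) by (intro smooth_affine smooth_deriv)
  then have cont: "continuous_on A K" for A by (rule smooth_continuous_on)
  have K_nonneg: "0 \<le> K t" for t unfolding K using S(2) c(2) by simp
  have K_support: "s < t \<and> t < c" if "K t \<noteq> 0" for t
    using that S(3)[of "u t"] c(2) by (simp add: K u field_simps)
  have "((\<lambda>t. S (u t)) has_real_derivative K t) (at t)" for t
    unfolding K u_def by (rule smooth_affine_has_derivative[OF S(1)])
  then have "(K has_integral S (u b) - S (u a)) {a..b}"
    using c by (intro fundamental_theorem_of_calculus)
      (auto simp flip: has_real_derivative_iff_has_vector_derivative intro: has_field_derivative_at_within)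
  moreover have "S (u b) = 1" "S (u a) = 0"
    using c by (auto intro!: S(4,5) simp: u divide_le_0_iff)
  ultimately have K_int: "(K has_integral 1) {a..b}" by simp
  have FK: "(\<lambda>t. F t * K t) integrable_on {a..b}"
    using F cont by (rule left_regulated_mult_continuous_integrable)
  have diff: "((\<lambda>t. F t * K t - F c * K t) has_integral integral {a..b} (\<lambda>t. F t * K t) - F c * 1) {a..b}"
    by (intro has_integral_diff has_integral_mult_right K_int integrable_integral FK)
  have bound: "((\<lambda>t. e * K t) has_integral e * 1) {a..b}"
    by (intro has_integral_mult_right K_int)
  have le: "norm (F t * K t - F c * K t) \<le> e * K t" for t
  proof (cases "K t = 0")
    case False
    then have "\<bar>F t - F c\<bar> * \<bar>K t\<bar> \<le> e * \<bar>K t\<bar>"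
      using K_support[OF False] close by (intro mult_right_mono) auto
    then show ?thesis
      using K_nonneg[of t] by (simp add: abs_mult flip: left_diff_distrib)
  qed simp
  have "norm (integral {a..b} (\<lambda>t. F t * K t - F c * K t)) \<le> integral {a..b} (\<lambda>t. e * K t)"
    by (rule integral_norm_bound_integral[OF has_integral_integrable[OF diff] has_integral_integrable[OF bound] le])
  then have "norm (integral {a..b} (\<lambda>t. F t * K t) - F c * 1) \<le> e * 1"
    unfolding integral_unique[OF diff] integral_unique[OF bound] .
  then show ?thesis by simp
qed

text \<open>The test function is the difference of a smooth step from \<open>0\<close> to \<open>1\<close> just before \<open>c\<close> and one just before
\<open>d\<close>; the steps cancel to the right of \<open>d\<close>. Testing against its derivative compares the left averages
of \<open>F\<close> at \<open>c\<close> and at \<open>d\<close>, which by left continuity are arbitrarily close to \<open>F(c)\<close> and \<open>F(d)\<close>.\<close>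

lemma zero_derivative_imp_constant:
  assumes F: "F \<in> R_lc a b" and zero: "dist_deriv_fun a b F = pw_zero"
    and cd: "a < c" "c < d" "d \<le> b"
  shows "F c = F d"
proof -
  obtain S :: "real \<Rightarrow> real" where S: "smooth S" "\<And>x. 0 \<le> deriv S x"
    "\<And>x. deriv S x \<noteq> 0 \<Longrightarrow> 0 < x \<and> x < 1" "\<And>x. x \<le> 0 \<Longrightarrow> S x = 0" "\<And>x. x \<ge> 1 \<Longrightarrow> S x = 1"
    using smooth_step_exists by metis
  have reg: "left_regulated a b F" "bounded (F ` {a..b})"
    using F by (auto simp: R_lc_def R_lr_def bounded_if_riemann_integrable)
  have "\<bar>F c - F d\<bar> \<le> 2 * e" if "e > 0" for e
  proof -
    have left_nbhd: "\<exists>s. a \<le> s \<and> s < x \<and> (\<forall>t. s < t \<longrightarrow> t < x \<longrightarrow> \<bar>F t - F x\<bar> \<le> e)" if "x \<in> {a<..b}" for x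
    proof -
      have "(F \<longlongrightarrow> F x) (at_left x)" using F that by (simp add: R_lc_def)
      from tendstoD[OF this \<open>e > 0\<close>] obtain s
        where s: "s < x" "\<And>t. s < t \<Longrightarrow> t < x \<Longrightarrow> dist (F t) (F x) < e"
        unfolding eventually_at_left_field by blast
      then show ?thesis using that
        by (intro exI[of _ "max s a"]) (auto simp: dist_real_def less_imp_le)
    qed
    have "c \<in> {a<..b}" "d \<in> {a<..b}" using cd by auto
    note left_nbhd[OF this(1)] left_nbhd[OF this(2)]
    then obtain s r where
      s: "a \<le> s" "s < c" "\<And>t. s < t \<Longrightarrow> t < c \<Longrightarrow> \<bar>F t - F c\<bar> \<le> e" and
      r: "a \<le> r" "r < d" "\<And>t. r < t \<Longrightarrow> t < d \<Longrightarrow> \<bar>F t - F d\<bar> \<le> e" by metis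
    define K where "K x y t = 1 / (y - x) * deriv S (1 / (y - x) * t + - x / (y - x))" for x y t
    define \<phi> where "\<phi> t = 1 * S (1 / (c - s) * t + - s / (c - s)) + (-1) * S (1 / (d - r) * t + - r / (d - r))" for t
    have step: "1 / (y - x) * t + - x / (y - x) = (t - x) / (y - x)" for x y t :: real
      by (simp add: diff_divide_distrib)
    have "\<phi> \<in> test_funs a b"
    proof (rule test_funI)
      show "smooth \<phi>"
        unfolding \<phi>_def by (intro smooth_add smooth_affine S(1))
      fix t assume "t \<notin> {a..b}"
      then consider "t \<le> s" "t \<le> r" | "t \<ge> c" "t \<ge> d" using s(1) r(1) cd by force
      then show "\<phi> t = 0"
      proof cases
        case 1
        then show ?thesis unfolding \<phi>_def step
          using s(2) r(2) S(4)[of "(t - s) / (c - s)"] S(4)[of "(t - r) / (d - r)"]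
          by (simp add: divide_le_0_iff)
      next
        case 2
        then show ?thesis unfolding \<phi>_def step
          using s(2) r(2) S(5)[of "(t - s) / (c - s)"] S(5)[of "(t - r) / (d - r)"] by simp
      qed
    qed
    have deriv_step: "((\<lambda>t. S (1 / (y - x) * t + - x / (y - x))) has_real_derivative K x y t) (at t)" for x y t
      unfolding K_def by (rule smooth_affine_has_derivative[OF S(1)])
    have "deriv \<phi> t = 1 * K s c t + (-1) * K r d t" for t
      unfolding \<phi>_def by (intro DERIV_imp_deriv DERIV_add DERIV_cmult deriv_step)
    moreover have "integral {a..b} (\<lambda>t. F t * deriv \<phi> t) = 0"
      using dist_deriv_fun_test[OF \<open>\<phi> \<in> test_funs a b\<close>, of F] zero by (simp add: pw_zero_def)
    ultimately have "integral {a..b} (\<lambda>t. F t * K s c t - F t * K r d t) = 0"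
      by (simp add: right_diff_distrib)
    moreover have "(\<lambda>t. F t * K x y t) integrable_on {a..b}" for x y
      unfolding K_def
      by (intro left_regulated_mult_continuous_integrable[OF reg] smooth_continuous_on smooth_affine
          smooth_deriv S(1))
    ultimately have "integral {a..b} (\<lambda>t. F t * K s c t) = integral {a..b} (\<lambda>t. F t * K r d t)"
      by (simp add: integral_diff)
    moreover have "\<bar>integral {a..b} (\<lambda>t. F t * K s c t) - F c\<bar> \<le> e"
      unfolding K_def using s cd by (intro left_average_close[OF reg S]) auto
    moreover have "\<bar>integral {a..b} (\<lambda>t. F t * K r d t) - F d\<bar> \<le> e"
      unfolding K_def using r cd by (intro left_average_close[OF reg S]) auto
    ultimately show ?thesis by linarith
  qed
  from this[of "\<bar>F c - F d\<bar> / 4"] show ?thesis by fastforce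
qed

text \<open>\<open>F\<close> is constant on \<open>(a, b]\<close>; right continuity at \<open>a\<close> carries the normalisation \<open>F(a) = 0\<close> over to that
constant.\<close>

lemma dist_deriv_fun_eq_zero:
  assumes "a < b" and F: "F \<in> R_lc0 a b" and zero: "dist_deriv_fun a b F = pw_zero"
  shows "F = pw_zero"
proof -
  have F': "F \<in> R_lc a b" "F a = 0" using F by (auto simp: R_lc0_def)
  have const: "F t = F b" if "a < t" "t \<le> b" for t
    using zero_derivative_imp_constant[OF F'(1) zero, of t b] that by (cases "t = b") auto
  have "eventually (\<lambda>t. F t = F b) (at_right a)"
    unfolding eventually_at_right_field by (intro exI[of _ b] conjI allI impI const \<open>a < b\<close>) simp_all
  then have "(F \<longlongrightarrow> F b) (at_right a)" by (rule tendsto_eventually)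
  moreover have "(F \<longlongrightarrow> F a) (at_right a)" using F'(1) by (simp add: R_lc_def)
  ultimately have "F b = F a" by (rule tendsto_unique[rotated]) simp
  then have inside: "F t = 0" if "t \<in> {a..b}" for t
    using const[of t] F'(2) that by (cases "t = a") auto
  have outside: "F t = 0" if "t \<notin> {a..b}" for t
    using F'(1) that by (simp add: R_lc_iff_bounded funs_on_def)
  have "F t = 0" for t using inside[of t] outside[of t] by blast
  then show ?thesis by (auto simp: pw_zero_def)
qed

lemma dist_deriv_fun_inj:
  assumes "a < b"
  shows "inj_on (dist_deriv_fun a b) (R_lc0 a b)"
proof (rule inj_onI)
  fix F G assume FG: "F \<in> R_lc0 a b" "G \<in> R_lc0 a b" "dist_deriv_fun a b F = dist_deriv_fun a b G"
  then have lc: "F \<in> R_lc a b" "pw_scale (-1) G \<in> R_lc a b" by (auto simp: R_lc0_def R_lc_scale)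
  define D where "D = pw_add F (pw_scale (-1) G)"
  have "D \<in> R_lc0 a b"
    using R_lc_add[OF lc] FG(1,2) by (simp add: R_lc0_def D_def pw_add_def pw_scale_def)
  moreover have "dist_deriv_fun a b D = pw_zero"
    unfolding D_def dist_deriv_fun_add[OF lc[THEN subsetD[OF R_lc_subset_R_lr]]] dist_deriv_fun_scale FG(3)
    by (simp add: pw_add_def pw_scale_def pw_zero_def)
  ultimately have "D = pw_zero" by (rule dist_deriv_fun_eq_zero[OF assms])
  then show "F = G" by (simp add: D_def pw_add_def pw_scale_def pw_zero_def fun_eq_iff)
qed

lemma dist_deriv_fun_bij:
  assumes "a < b"
  shows "bij_betw (dist_deriv_fun a b) (R_lc0 a b) (A_R a b)"
  unfolding bij_betw_def
proof
  have lr: "F \<in> R_lr a b" if "F \<in> R_lc0 a b" for F using that by (simp add: R_lc0_def R_lc_def)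
  show "dist_deriv_fun a b ` R_lc0 a b = A_R a b"
  proof (intro subset_antisym subsetI)
    fix f assume "f \<in> dist_deriv_fun a b ` R_lc0 a b"
    then obtain F where "F \<in> R_lc0 a b" "f = dist_deriv_fun a b F" by blast
    with lr[of F] dist_deriv_fun_in_distributions[of F a b] show "f \<in> A_R a b"
      unfolding A_R_def by (auto simp: dist_deriv_fun_def)
  next
    fix f assume "f \<in> A_R a b"
    then obtain H where H: "H \<in> R_lr a b" "f = dist_deriv_fun a b H"
      by (auto simp: A_R_def dist_deriv_fun_def)
    obtain F where "F \<in> R_lc0 a b" "dist_deriv_fun a b F = dist_deriv_fun a b H"
      using primitive_exists[OF assms H(1)] .
    then show "f \<in> dist_deriv_fun a b ` R_lc0 a b"
      by (intro image_eqI[of _ _ F]) (simp_all add: H(2))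
  qed
qed (rule dist_deriv_fun_inj[OF assms])

section \<open>The Banach algebra of derivatives\<close>

lemma primitive_dist_deriv_fun:
  assumes "a < b" "F \<in> R_lc0 a b"
  shows "primitive a b (dist_deriv_fun a b F) = F"
  unfolding primitive_def dist_deriv_fun_def[symmetric]
  using assms(2) inj_onD[OF dist_deriv_fun_inj[OF assms(1)]] by (intro the_equality) auto

lemma A_R_mult_dist_deriv_fun:
  assumes "a < b" "F \<in> R_lc0 a b" "G \<in> R_lc0 a b"
  shows "A_R_mult a b (dist_deriv_fun a b F) (dist_deriv_fun a b G) = dist_deriv_fun a b (pw_mult F G)"
  using assms by (simp add: A_R_mult_def primitive_dist_deriv_fun flip: dist_deriv_fun_def)

lemma A_R_comm_banach_algebra:
  assumes "a < b"
  shows "comm_banach_algebra_on (A_R a b) pw_add pw_zero pw_scale (A_R_norm a b) (A_R_mult a b)"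
proof (rule comm_banach_algebra_on_transport[OF R_lc0_comm_banach_algebra dist_deriv_fun_bij])
  have lr: "F \<in> R_lr a b" if "F \<in> R_lc0 a b" for F using that by (simp add: R_lc0_def R_lc_def)
  show "pw_add (dist_deriv_fun a b F) (dist_deriv_fun a b G) = dist_deriv_fun a b (pw_add F G)"
    if "F \<in> R_lc0 a b" "G \<in> R_lc0 a b" for F G
    using that by (simp add: dist_deriv_fun_add lr)
  show "pw_zero = dist_deriv_fun a b pw_zero"
  proof
    fix \<phi> :: "real \<Rightarrow> real"
    show "pw_zero \<phi> = dist_deriv_fun a b pw_zero \<phi>"
      by (cases "\<phi> \<in> test_funs a b")
        (simp_all add: dist_deriv_fun_test dist_deriv_fun_not_test pw_zero_def)
  qed
  show "pw_scale c (dist_deriv_fun a b F) = dist_deriv_fun a b (pw_scale c F)" for c F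
    by (simp add: dist_deriv_fun_scale)
  show "A_R_norm a b (dist_deriv_fun a b F) = sup_norm a b F" if "F \<in> R_lc0 a b" for F
    using assms that by (simp add: A_R_norm_def primitive_dist_deriv_fun)
qed (simp_all add: assms A_R_mult_dist_deriv_fun)

text \<open>The primitive \<open>E\<close> of a unit would satisfy \<open>E(t) (t - a) = t - a\<close>, hence equal \<open>1\<close> right of \<open>a\<close>, although
it must tend to \<open>E(a) = 0\<close> there.\<close>

lemma A_R_no_unit:
  assumes "a < b" "e \<in> A_R a b"
  shows "\<exists>f\<in>A_R a b. A_R_mult a b e f \<noteq> f"
proof (rule ccontr)
  assume "\<not> ?thesis"
  then have unit: "A_R_mult a b e f = f" if "f \<in> A_R a b" for f using that by blast
  obtain E where E: "E \<in> R_lc0 a b" "e = dist_deriv_fun a b E"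
    using assms(2) bij_betw_imp_surj_on[OF dist_deriv_fun_bij[OF assms(1)]] by blast
  define F where "F t = (t - a) * one_on a b t" for t
  have "F \<in> R_lc a b"
    unfolding R_lc_iff_bounded
  proof (intro conjI ballI)
    show "F \<in> funs_on a b" by (simp add: funs_on_def F_def one_on_def)
    show "bounded (F ` {a..b})"
      unfolding bounded_image_real_iff by (intro exI[of _ "b - a"]) (simp add: F_def one_on_def)
    show "(F \<longlongrightarrow> F t) (at_left t)" if "t \<in> {a<..b}" for t
      unfolding F_def using one_on_R_lc[OF assms(1)] that
      by (intro tendsto_intros) (simp add: R_lc_iff_bounded)
    show "(F \<longlongrightarrow> F a) (at_right a)"
      unfolding F_def using one_on_R_lc[OF assms(1)]
      by (intro tendsto_intros) (simp add: R_lc_iff_bounded)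
  qed
  then have F: "F \<in> R_lc0 a b" by (simp add: R_lc0_def F_def)
  have EF: "pw_mult E F \<in> R_lc0 a b"
    using E(1) F by (simp add: R_lc0_def R_lc_mult) (simp add: pw_mult_def)
  have "dist_deriv_fun a b F \<in> A_R a b"
    using F bij_betw_imp_surj_on[OF dist_deriv_fun_bij[OF assms(1)]] by blast
  from unit[OF this] have "dist_deriv_fun a b (pw_mult E F) = dist_deriv_fun a b F"
    by (simp add: E A_R_mult_dist_deriv_fun assms(1) F)
  then have "pw_mult E F = F" by (rule inj_onD[OF dist_deriv_fun_inj[OF assms(1)] _ EF F])
  then have EF_eq: "E t * F t = F t" for t by (simp add: pw_mult_def fun_eq_iff)
  have "E t = 1" if "a < t" "t < b" for t
    using EF_eq[of t] that by (simp add: F_def one_on_def)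
  then have "eventually (\<lambda>t. E t = 1) (at_right a)"
    unfolding eventually_at_right_field using assms(1) by blast
  then have "(E \<longlongrightarrow> 1) (at_right a)" by (rule tendsto_eventually)
  moreover have "(E \<longlongrightarrow> E a) (at_right a)" "E a = 0"
    using E(1) unfolding R_lc0_def R_lc_def by blast+
  ultimately show False using tendsto_unique[of "at_right a" E 1 "E a"] by simp
qed

theorem theorem5p2:
  fixes a b :: real
  assumes "a < b"
  shows
    "(comm_banach_algebra_on (R_lc0 a b) pw_add pw_zero pw_scale (sup_norm a b) pw_mult \<and>
      comm_banach_algebra_on (R_lc a b) pw_add pw_zero pw_scale (sup_norm a b) pw_mult) \<and>
     (comm_banach_algebra_on (A_R a b) pw_add pw_zero pw_scale (A_R_norm a b) (A_R_mult a b) \<and>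
      \<not> (\<exists>e\<in>A_R a b. \<forall>f\<in>A_R a b. A_R_mult a b e f = f \<and> A_R_mult a b f e = f))"
  using R_lc0_comm_banach_algebra[OF assms] R_lc_comm_banach_algebra[OF assms]
    A_R_comm_banach_algebra[OF assms] A_R_no_unit[OF assms] by blast

end
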